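(* Let $q$ be a power of a prime and $n$ a positive integer with $\gcd(n,q)=1$. With the notation $f_j,r,s,\epsilon,e_f$ of the context, the dihedral group algebra $\mathbb F_qD_{2n}$ has exactly $\epsilon+r+s$ central irreducible idempotents, namely: (1) the $2\epsilon$ idempotents $\frac{1+y}{2}e_{f_j}$ and $\frac{1-y}{2}e_{f_j}$, where $1\le j\le\epsilon$; (2) the $r-\epsilon$ idempotents $e_{f_j}$, where $j=\epsilon+1,\dots,r$; (3) the $s$ idempotents $e_{f_j}+e_{f_j^*}$, where $j=r+1,\dots,r+s$.
   Context: $\mathbb F_q$ is the finite field with $q$ elements. $D_{2n}=\langle x,y\mid x^n=1,\ y^2=1,\ xy=yx^{-1}\rangle$ is the dihedral group of order $2n$. A central irreducible idempotent is a nonzero central idempotent that is not a sum of two nonzero orthogonal central idempotents. For a polynomial $g\in\mathbb F_q[x]$ with $g(0)\neq0$, its reciprocal polynomial is $g^*(x)=x^{\deg g}g(1/x)$. The polynomial $x^n-1$ factors into pairwise distinct monic irreducible factors in $\mathbb F_q[x]$ as $$x^n-1=f_1f_2\cdots f_r\,f_{r+1}f_{r+1}^*\cdots f_{r+s}f_{r+s}^*,$$ where reciprocals are taken up to a nonzero scalar (i.e. normalized to be monic), $f_1=x-1$, $f_2=x+1$ if $n$ is even, the factors $f_1,\dots,f_r$ are exactly the irreducible factors that are auto-reciprocal (equal to their reciprocal up to a nonzero scalar), and the remaining $2s$ factors are non-auto-reciprocal and grouped in pairs $f_j,f_j^*$. Define $\epsilon=0$ if $\operatorname{char}(\mathbb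 F_q)=2$, $\epsilon=1$ if $\operatorname{char}(\mathbb F_q)\neq2$ and $n$ is odd, $\epsilon=2$ if $\operatorname{char}(\mathbb F_q)\ne2$ and $n$ is even. For a non-constant divisor $f$ of $x^n-1$ in $\mathbb F_q[x]$, put $$e_f=-\frac1n\cdot x^{\deg f-1}\,(f^* )'(1/x)\cdot\frac{x^n-1}{f},$$ where $'$ denotes the formal derivative (so $x^{\deg f-1}(f^* )'(1/x)$ is the reciprocal of $(f^* )'$ taken with respect to the degree $\deg f-1$); $e_f$ is unchanged when $f$ is multiplied by a nonzero scalar. It is regarded as an element of $\mathbb F_qD_{2n}$ by substituting the group generator $x$ for the variable. *)

theory Defs
  imports
    "HOL-Algebra.Module"
    "HOL-Algebra.Generated_Groups"
    "HOL-Computational_Algebra.Polynomial"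
    "HOL-Library.Cardinality"
begin

section \<open>The dihedral group\<close>

text \<open>
  The pair \<open>(i, b)\<close> stands for the normal form \<open>x\<^sup>i\<close> (if \<open>b\<close> is false) or
  \<open>x\<^sup>i y\<close> (if \<open>b\<close> is true).  The multiplication is the one
  forced by \<open>y x\<^sup>k = x\<^sup>-\<^sup>k y\<close>.  For \<open>n = 1\<close> and \<open>n = 2\<close> this gives the
  cyclic group of order 2 and the Klein four-group.
\<close>

definition dihedral_group :: "nat \<Rightarrow> (int \<times> bool) monoid" where
  "dihedral_group n =
     \<lparr>carrier = {0..<int n} \<times> UNIV,
      monoid.mult = (\<lambda>(i, b) (k, c). ((if b then i - k else i + k) mod int n, b \<noteq> c)),
      one = (0, False)\<rparr>"

definition dihedral_x :: "nat \<Rightarrow> int \<times> bool" where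
  "dihedral_x n = (1 mod int n, False)"

definition dihedral_y :: "int \<times> bool" where
  "dihedral_y = (0, True)"

lemma dihedral_group_group:
  assumes "n > 0"
  shows "group (dihedral_group n)"
proof (rule groupI)
  fix a b c
  assume "a \<in> carrier (dihedral_group n)" "b \<in> carrier (dihedral_group n)"
    "c \<in> carrier (dihedral_group n)"
  show "a \<otimes>\<^bsub>dihedral_group n\<^esub> b \<otimes>\<^bsub>dihedral_group n\<^esub> c =
        a \<otimes>\<^bsub>dihedral_group n\<^esub> (b \<otimes>\<^bsub>dihedral_group n\<^esub> c)"
    by (cases a; cases b; cases c)
       (auto simp: dihedral_group_def mod_simps algebra_simps)
next
  fix a assume a: "a \<in> carrier (dihedral_group n)"
  obtain i b where ib: "a = (i, b)" by (cases a)
  show "\<exists>y\<in>carrier (dihedral_group n). y \<otimes>\<^bsub>dihedral_group n\<^esub> a = \<one>\<^bsub>dihedral_group n\<^esub>"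
    using a assms ib
    by (intro bexI[of _ "(if b then i else (- i) mod int n, b)"])
       (auto simp: dihedral_group_def mod_simps)
qed (use assms in \<open>auto simp: dihedral_group_def\<close>)

lemma order_dihedral_group: "Coset.order (dihedral_group n) = 2 * n"
  by (simp add: Coset.order_def dihedral_group_def card_cartesian_product)

lemma dihedral_x_pow:
  "dihedral_x n [^]\<^bsub>dihedral_group n\<^esub> (k::nat) = (int k mod int n, False)"
proof (induction k)
  case 0
  show ?case by (simp add: dihedral_group_def nat_pow_def)
next
  case (Suc k)
  have "dihedral_x n [^]\<^bsub>dihedral_group n\<^esub> Suc k
      = (dihedral_x n [^]\<^bsub>dihedral_group n\<^esub> k) \<otimes>\<^bsub>dihedral_group n\<^esub> dihedral_x n"
    by (simp add: nat_pow_def)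
  also have "\<dots> = (int (Suc k) mod int n, False)"
    unfolding Suc by (simp add: dihedral_group_def dihedral_x_def mod_simps algebra_simps)
  finally show ?case .
qed

lemma dihedral_normal_form:
  assumes "(i, b) \<in> carrier (dihedral_group n)"
  shows "(i, b) = dihedral_x n [^]\<^bsub>dihedral_group n\<^esub> nat i \<otimes>\<^bsub>dihedral_group n\<^esub>
           (if b then dihedral_y else \<one>\<^bsub>dihedral_group n\<^esub>)"
  using assms unfolding dihedral_x_pow by (auto simp: dihedral_group_def dihedral_y_def)

lemma dihedral_relations:
  assumes "n > 0"
  shows "dihedral_x n \<in> carrier (dihedral_group n)"
    and "dihedral_y \<in> carrier (dihedral_group n)"
    and "dihedral_x n [^]\<^bsub>dihedral_group n\<^esub> n = \<one>\<^bsub>dihedral_group n\<^esub>"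
    and "dihedral_y [^]\<^bsub>dihedral_group n\<^esub> (2::nat) = \<one>\<^bsub>dihedral_group n\<^esub>"
    and "dihedral_x n \<otimes>\<^bsub>dihedral_group n\<^esub> dihedral_y =
         dihedral_y \<otimes>\<^bsub>dihedral_group n\<^esub> inv\<^bsub>dihedral_group n\<^esub> dihedral_x n"
proof -
  interpret group "dihedral_group n" by (rule dihedral_group_group[OF assms])
  show x: "dihedral_x n \<in> carrier (dihedral_group n)"
    and y: "dihedral_y \<in> carrier (dihedral_group n)"
    using assms by (auto simp: dihedral_group_def dihedral_x_def dihedral_y_def)
  show "dihedral_x n [^]\<^bsub>dihedral_group n\<^esub> n = \<one>\<^bsub>dihedral_group n\<^esub>"
    unfolding dihedral_x_pow by (simp add: dihedral_group_def)
  show "dihedral_y [^]\<^bsub>dihedral_group n\<^esub> (2::nat) = \<one>\<^bsub>dihedral_group n\<^esub>"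
    by (simp add: numeral_2_eq_2 nat_pow_def dihedral_group_def dihedral_y_def)
  have "inv\<^bsub>dihedral_group n\<^esub> dihedral_x n = ((- 1) mod int n, False)"
    by (rule inv_equality)
       (use assms x in \<open>auto simp: dihedral_group_def dihedral_x_def mod_simps\<close>)
  then show "dihedral_x n \<otimes>\<^bsub>dihedral_group n\<^esub> dihedral_y =
         dihedral_y \<otimes>\<^bsub>dihedral_group n\<^esub> inv\<^bsub>dihedral_group n\<^esub> dihedral_x n"
    by (simp add: dihedral_group_def dihedral_x_def dihedral_y_def mod_simps)
qed

text \<open>
  Generation and the universal property: \<^term>\<open>dihedral_group n\<close> is the group presented by
  \<open>x\<^sup>n = 1\<close>, \<open>y\<^sup>2 = 1\<close>, \<open>x y = y x\<^sup>-\<^sup>1\<close>.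
\<close>

lemma dihedral_generate:
  assumes "n > 0"
  shows "generate (dihedral_group n) {dihedral_x n, dihedral_y} = carrier (dihedral_group n)"
proof -
  interpret group "dihedral_group n" by (rule dihedral_group_group[OF assms])
  let ?H = "generate (dihedral_group n) {dihedral_x n, dihedral_y}"
  have sub: "{dihedral_x n, dihedral_y} \<subseteq> carrier (dihedral_group n)"
    using dihedral_relations(1,2)[OF assms] by simp
  have pow: "dihedral_x n [^]\<^bsub>dihedral_group n\<^esub> (k::nat) \<in> ?H" for k
  proof (induction k)
    case 0
    show ?case by (simp add: generate.one)
  next
    case (Suc k)
    then show ?case by (auto intro: generate.eng generate.incl)
  qed
  have "a \<in> ?H" if "a \<in> carrier (dihedral_group n)" for a
  proof (cases a)
    case (Pair i b)
    show ?thesis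
      using that unfolding Pair
      by (subst dihedral_normal_form) (auto intro!: generate.eng pow intro: generate.one generate.incl)
  qed
  moreover have "?H \<subseteq> carrier (dihedral_group n)"
    using generate_incl[OF sub] .
  ultimately show ?thesis by blast
qed

lemma dihedral_universal:
  fixes H (structure)
  assumes n: "n > 0" and H: "group H" and a: "a \<in> carrier H" and b: "b \<in> carrier H"
    and an: "a [^] n = \<one>" and b2: "b [^] (2::nat) = \<one>" and ab: "a \<otimes> b = b \<otimes> inv a"
  shows "\<exists>h \<in> hom (dihedral_group n) H. h (dihedral_x n) = a \<and> h dihedral_y = b"
proof -
  interpret group H by fact
  have an': "a [^] (int n * k) = \<one>" for k
    by (metis a an int_pow_int int_pow_one int_pow_pow)
  have pmod: "a [^] (k mod int n) = a [^] k" for k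
  proof -
    have "a [^] k = a [^] (int n * (k div int n) + k mod int n)" by simp
    also have "\<dots> = a [^] (k mod int n)"
      unfolding int_pow_mult[OF a] an' using a by simp
    finally show ?thesis by simp
  qed
  have bb: "b \<otimes> b = \<one>"
    using b2 b by (simp add: numeral_2_eq_2)
  have bab: "b \<otimes> a \<otimes> b = inv a"
    using a b ab bb by (metis inv_closed l_one m_assoc)
  have bkn: "b \<otimes> a [^] (k::nat) = inv (a [^] k) \<otimes> b" for k
  proof (induction k)
    case 0
    then show ?case using b by simp
  next
    case (Suc k)
    have ba: "b \<otimes> a = inv a \<otimes> b"
      using bab bb a b by (metis m_assoc m_closed r_one)
    have "b \<otimes> a [^] Suc k = (b \<otimes> a [^] k) \<otimes> a"
      using a b by (simp add: m_assoc)
    also have "\<dots> = inv (a [^] k) \<otimes> (b \<otimes> a)"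
      unfolding Suc using a b by (simp add: m_assoc)
    also have "\<dots> = inv (a [^] k) \<otimes> inv a \<otimes> b"
      unfolding ba using a b by (simp add: m_assoc)
    also have "inv (a [^] k) \<otimes> inv a = inv (a [^] Suc k)"
      using a by (metis inv_mult_group nat_pow_Suc2 nat_pow_closed nat_pow_Suc)
    finally show ?case .
  qed
  have bk: "b \<otimes> a [^] (k::int) = a [^] (- k) \<otimes> b" for k
  proof (cases k)
    case (nonneg m)
    then show ?thesis using bkn[of m] a by (simp add: int_pow_neg int_pow_int)
  next
    case (neg m)
    let ?c = "a [^] Suc m"
    have c: "?c \<in> carrier H" using a by simp
    have "b \<otimes> inv ?c = b \<otimes> (inv ?c \<otimes> b) \<otimes> b"
      using c b bb by (simp add: m_assoc)
    also have "\<dots> = b \<otimes> (b \<otimes> ?c) \<otimes> b" using bkn[of "Suc m"] by simp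
    also have "\<dots> = ?c \<otimes> b" using c b bb by (simp add: m_assoc[symmetric])
    finally show ?thesis using neg a by (simp add: int_pow_neg int_pow_int del: of_nat_Suc nat_pow_Suc)
  qed
  define h where "h = (\<lambda>(i::int, c). a [^] i \<otimes> (if c then b else \<one>))"
  have "h \<in> hom (dihedral_group n) H"
  proof (rule homI)
    fix u assume "u \<in> carrier (dihedral_group n)"
    show "h u \<in> carrier H" using a b by (auto simp: h_def split: prod.splits)
  next
    fix u v :: "int \<times> bool"
    obtain i c k d where uv: "u = (i, c)" "v = (k, d)" by (cases u, cases v)
    have e: "b \<otimes> (a [^] k \<otimes> t) = a [^] (- k) \<otimes> (b \<otimes> t)" if "t \<in> carrier H" for t
      using that a b bk[of k] by (simp add: m_assoc[symmetric])
    have m: "a [^] i \<otimes> (a [^] l \<otimes> t) = a [^] (i + l) \<otimes> t" if "t \<in> carrier H" for t and l :: int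
      using that a by (simp add: m_assoc int_pow_mult)
    show "h (u \<otimes>\<^bsub>dihedral_group n\<^esub> v) = h u \<otimes> h v"
      using a b bb e[OF b] e[OF one_closed] m[OF b] m[OF one_closed]
      by (auto simp: uv h_def dihedral_group_def pmod m_assoc int_pow_mult[symmetric])
  qed
  moreover have "h (dihedral_x n) = a"
    using a pmod[of 1] by (simp add: h_def dihedral_x_def)
  moreover have "h dihedral_y = b"
    using b by (simp add: h_def dihedral_y_def)
  ultimately show ?thesis by blast
qed


section \<open>The group algebra\<close>

text \<open>
  Elements of \<open>K[G]\<close> are finitely supported functions that vanish outside \<^term>\<open>carrier G\<close>;
  the product is convolution.
\<close>

definition group_algebra :: "('g, 'z) monoid_scheme \<Rightarrow> ('a::comm_ring_1, 'g \<Rightarrow> 'a) module" where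
  "group_algebra G =
     \<lparr>carrier = {a. finite {g. a g \<noteq> 0} \<and> {g. a g \<noteq> 0} \<subseteq> carrier G},
      monoid.mult = (\<lambda>a b g. \<Sum>h | a h \<noteq> 0. \<Sum>k | b k \<noteq> 0. if h \<otimes>\<^bsub>G\<^esub> k = g then a h * b k else 0),
      one = (\<lambda>g. if g = \<one>\<^bsub>G\<^esub> then 1 else 0),
      zero = (\<lambda>g. 0),
      add = (\<lambda>a b g. a g + b g),
      module.smult = (\<lambda>c a g. c * a g)\<rparr>"

definition basis_elem :: "'g \<Rightarrow> 'g \<Rightarrow> 'a::comm_ring_1" where
  "basis_elem g = (\<lambda>h. if h = g then 1 else 0)"

lemma group_algebra_mult_superset:
  assumes "finite S" "finite T" "{g. a g \<noteq> 0} \<subseteq> S" "{g. b g \<noteq> 0} \<subseteq> T"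
  shows "(a \<otimes>\<^bsub>group_algebra G\<^esub> b) g =
    (\<Sum>h\<in>S. \<Sum>k\<in>T. if h \<otimes>\<^bsub>G\<^esub> k = g then a h * b k else 0)"
proof -
  have "(a \<otimes>\<^bsub>group_algebra G\<^esub> b) g =
      (\<Sum>h | a h \<noteq> 0. \<Sum>k\<in>T. if h \<otimes>\<^bsub>G\<^esub> k = g then a h * b k else 0)"
    unfolding group_algebra_def
    by (simp, intro sum.cong refl sum.mono_neutral_left) (use assms in auto)
  also have "\<dots> = (\<Sum>h\<in>S. \<Sum>k\<in>T. if h \<otimes>\<^bsub>G\<^esub> k = g then a h * b k else 0)"
    by (intro sum.mono_neutral_left) (use assms in \<open>auto simp: sum.neutral\<close>)
  finally show ?thesis .
qed

lemma group_algebra_mult_support: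
  "{g. (a \<otimes>\<^bsub>group_algebra G\<^esub> b) g \<noteq> 0} \<subseteq>
     (\<lambda>(h, k). h \<otimes>\<^bsub>G\<^esub> k) ` ({g. a g \<noteq> 0} \<times> {g. b g \<noteq> 0})"
proof
  fix g assume "g \<in> {g. (a \<otimes>\<^bsub>group_algebra G\<^esub> b) g \<noteq> 0}"
  then have "(\<Sum>h | a h \<noteq> 0. \<Sum>k | b k \<noteq> 0. if h \<otimes>\<^bsub>G\<^esub> k = g then a h * b k else 0) \<noteq> 0"
    by (simp add: group_algebra_def)
  then obtain h where h: "a h \<noteq> 0"
      "(\<Sum>k | b k \<noteq> 0. if h \<otimes>\<^bsub>G\<^esub> k = g then a h * b k else 0) \<noteq> 0"
    by (auto elim: sum.not_neutral_contains_not_neutral)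
  then obtain k where k: "b k \<noteq> 0" "(if h \<otimes>\<^bsub>G\<^esub> k = g then a h * b k else 0) \<noteq> 0"
    by (auto elim: sum.not_neutral_contains_not_neutral)
  then have "h \<otimes>\<^bsub>G\<^esub> k = g" by (auto split: if_splits)
  with h(1) k(1) show "g \<in> (\<lambda>(h, k). h \<otimes>\<^bsub>G\<^esub> k) ` ({g. a g \<noteq> 0} \<times> {g. b g \<noteq> 0})"
    by force
qed

lemma group_algebra_ring:
  fixes G (structure)
  assumes "group G"
  shows "ring (group_algebra G :: ('a::comm_ring_1, _) module)"
proof -
  interpret group G by fact
  let ?A = "group_algebra G :: ('a, _) module"
  have car: "a \<in> carrier ?A \<longleftrightarrow> finite {g. a g \<noteq> 0} \<and> {g. a g \<noteq> 0} \<subseteq> carrier G" for a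
    by (simp add: group_algebra_def)
  have add: "a \<oplus>\<^bsub>?A\<^esub> b = (\<lambda>g. a g + b g)" for a b
    by (simp add: group_algebra_def)
  have add_cl: "a \<oplus>\<^bsub>?A\<^esub> b \<in> carrier ?A" if "a \<in> carrier ?A" "b \<in> carrier ?A" for a b
  proof -
    have "{g. a g + b g \<noteq> 0} \<subseteq> {g. a g \<noteq> 0} \<union> {g. b g \<noteq> 0}" by auto
    with that show ?thesis unfolding car add
      by (meson finite_UnI finite_subset le_sup_iff order_trans)
  qed
  have mult_cl: "a \<otimes>\<^bsub>?A\<^esub> b \<in> carrier ?A" if "a \<in> carrier ?A" "b \<in> carrier ?A" for a b
  proof -
    have "finite ((\<lambda>(h, k). h \<otimes> k) ` ({g. a g \<noteq> 0} \<times> {g. b g \<noteq> 0}))"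
      using that unfolding car by blast
    moreover have "(\<lambda>(h, k). h \<otimes> k) ` ({g. a g \<noteq> 0} \<times> {g. b g \<noteq> 0}) \<subseteq> carrier G"
      using that unfolding car by auto
    ultimately show ?thesis unfolding car
      using group_algebra_mult_support[of G a b] by (meson finite_subset order_trans)
  qed
  show ?thesis
  proof (rule ringI)
    show "abelian_group ?A"
    proof (rule abelian_groupI)
      fix a assume a: "a \<in> carrier ?A"
      then have "(\<lambda>g. - a g) \<in> carrier ?A" by (simp add: car)
      then show "\<exists>b\<in>carrier ?A. b \<oplus>\<^bsub>?A\<^esub> a = \<zero>\<^bsub>?A\<^esub>"
        by (intro bexI[of _ "\<lambda>g. - a g"]) (auto simp: group_algebra_def)
    qed (use add_cl in \<open>auto simp: group_algebra_def algebra_simps\<close>)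
    show "Group.monoid ?A"
    proof (rule monoidI)
      show "\<one>\<^bsub>?A\<^esub> \<in> carrier ?A"
        by (auto simp: group_algebra_def)
    next
      fix a assume a: "a \<in> carrier ?A"
      then have fa: "finite {g. a g \<noteq> 0}" and sa: "\<And>g. a g \<noteq> 0 \<Longrightarrow> g \<in> carrier G"
        by (auto simp: car)
      have *: "(\<Sum>k | a k \<noteq> 0. if k = g then a k else 0) = a g" for g
        using fa by simp
      show "\<one>\<^bsub>?A\<^esub> \<otimes>\<^bsub>?A\<^esub> a = a"
      proof
        fix g
        have "(\<one>\<^bsub>?A\<^esub> \<otimes>\<^bsub>?A\<^esub> a) g = (\<Sum>h\<in>{\<one>}. \<Sum>k | a k \<noteq> 0.
            if h \<otimes> k = g then (\<one>\<^bsub>?A\<^esub>) h * a k else 0)"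
          by (rule group_algebra_mult_superset) (use fa in \<open>auto simp: group_algebra_def\<close>)
        also have "\<dots> = (\<Sum>k | a k \<noteq> 0. if k = g then a k else 0)"
          by simp (rule sum.cong, use sa in \<open>auto simp: group_algebra_def\<close>)
        finally show "(\<one>\<^bsub>?A\<^esub> \<otimes>\<^bsub>?A\<^esub> a) g = a g" using * by simp
      qed
      show "a \<otimes>\<^bsub>?A\<^esub> \<one>\<^bsub>?A\<^esub> = a"
      proof
        fix g
        have "(a \<otimes>\<^bsub>?A\<^esub> \<one>\<^bsub>?A\<^esub>) g = (\<Sum>h | a h \<noteq> 0. \<Sum>k\<in>{\<one>}.
            if h \<otimes> k = g then a h * (\<one>\<^bsub>?A\<^esub>) k else 0)"
          by (rule group_algebra_mult_superset) (use fa in \<open>auto simp: group_algebra_def\<close>)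
        also have "\<dots> = (\<Sum>k | a k \<noteq> 0. if k = g then a k else 0)"
          by simp (rule sum.cong, use sa in \<open>auto simp: group_algebra_def\<close>)
        finally show "(a \<otimes>\<^bsub>?A\<^esub> \<one>\<^bsub>?A\<^esub>) g = a g" using * by simp
      qed
    next
      fix a b c assume abc: "a \<in> carrier ?A" "b \<in> carrier ?A" "c \<in> carrier ?A"
      let ?S = "{g. a g \<noteq> 0}" and ?T = "{g. b g \<noteq> 0}" and ?U = "{g. c g \<noteq> 0}"
      have fin: "finite ?S" "finite ?T" "finite ?U" using abc by (auto simp: car)
      have cc: "\<And>g. a g \<noteq> 0 \<Longrightarrow> g \<in> carrier G" "\<And>g. b g \<noteq> 0 \<Longrightarrow> g \<in> carrier G"
        "\<And>g. c g \<noteq> 0 \<Longrightarrow> g \<in> carrier G" using abc by (auto simp: car)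
      let ?V = "(\<lambda>(h, k). h \<otimes> k) ` (?S \<times> ?T)" and ?W = "(\<lambda>(h, k). h \<otimes> k) ` (?T \<times> ?U)"
      have finV: "finite ?V" and finW: "finite ?W" using fin by blast+
      show "a \<otimes>\<^bsub>?A\<^esub> b \<otimes>\<^bsub>?A\<^esub> c = a \<otimes>\<^bsub>?A\<^esub> (b \<otimes>\<^bsub>?A\<^esub> c)"
      proof
        fix g
        have "(a \<otimes>\<^bsub>?A\<^esub> b \<otimes>\<^bsub>?A\<^esub> c) g =
            (\<Sum>u\<in>?V. \<Sum>l\<in>?U. if u \<otimes> l = g then (a \<otimes>\<^bsub>?A\<^esub> b) u * c l else 0)"
          by (rule group_algebra_mult_superset[OF finV fin(3) group_algebra_mult_support order_refl])
        also have "\<dots> = (\<Sum>u\<in>?V. \<Sum>l\<in>?U. \<Sum>h\<in>?S. \<Sum>k\<in>?T.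
            if h \<otimes> k = u then (if u \<otimes> l = g then a h * b k * c l else 0) else 0)"
          unfolding group_algebra_mult_superset[OF fin(1,2) order_refl order_refl]
        proof (intro sum.cong refl)
          fix u l
          show "(if u \<otimes> l = g then (\<Sum>h\<in>?S. \<Sum>k\<in>?T. if h \<otimes> k = u then a h * b k else 0) * c l
              else 0) = (\<Sum>h\<in>?S. \<Sum>k\<in>?T.
            if h \<otimes> k = u then (if u \<otimes> l = g then a h * b k * c l else 0) else 0)"
            by (cases "u \<otimes> l = g") (auto simp: sum_distrib_right intro!: sum.cong sum.neutral)
        qed
        also have "\<dots> = (\<Sum>u\<in>?V. \<Sum>h\<in>?S. \<Sum>l\<in>?U. \<Sum>k\<in>?T.
            if h \<otimes> k = u then (if u \<otimes> l = g then a h * b k * c l else 0) else 0)"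
          by (intro sum.cong refl sum.swap)
        also have "\<dots> = (\<Sum>u\<in>?V. \<Sum>h\<in>?S. \<Sum>k\<in>?T. \<Sum>l\<in>?U.
            if h \<otimes> k = u then (if u \<otimes> l = g then a h * b k * c l else 0) else 0)"
          by (intro sum.cong refl sum.swap)
        also have "\<dots> = (\<Sum>h\<in>?S. \<Sum>u\<in>?V. \<Sum>k\<in>?T. \<Sum>l\<in>?U.
            if h \<otimes> k = u then (if u \<otimes> l = g then a h * b k * c l else 0) else 0)"
          by (rule sum.swap)
        also have "\<dots> = (\<Sum>h\<in>?S. \<Sum>k\<in>?T. \<Sum>u\<in>?V. \<Sum>l\<in>?U.
            if h \<otimes> k = u then (if u \<otimes> l = g then a h * b k * c l else 0) else 0)"
          by (intro sum.cong refl sum.swap)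
        also have "\<dots> = (\<Sum>h\<in>?S. \<Sum>k\<in>?T. \<Sum>l\<in>?U. \<Sum>u\<in>?V.
            if h \<otimes> k = u then (if u \<otimes> l = g then a h * b k * c l else 0) else 0)"
          by (intro sum.cong refl sum.swap)
        also have "\<dots> = (\<Sum>h\<in>?S. \<Sum>k\<in>?T. \<Sum>l\<in>?U.
            if h \<otimes> k \<otimes> l = g then a h * b k * c l else 0)"
        proof (intro sum.cong refl)
          fix h k l assume "h \<in> ?S" "k \<in> ?T"
          then have "h \<otimes> k \<in> ?V" by blast
          then show "(\<Sum>u\<in>?V. if h \<otimes> k = u then (if u \<otimes> l = g then a h * b k * c l else 0) else 0)
            = (if h \<otimes> k \<otimes> l = g then a h * b k * c l else 0)"
            by (subst sum.delta'[OF finV]) simp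
        qed
        also have "\<dots> = (\<Sum>h\<in>?S. \<Sum>k\<in>?T. \<Sum>l\<in>?U.
            if h \<otimes> (k \<otimes> l) = g then a h * (b k * c l) else 0)"
          by (intro sum.cong refl) (auto simp: m_assoc cc mult.assoc)
        also have "\<dots> = (\<Sum>h\<in>?S. \<Sum>k\<in>?T. \<Sum>l\<in>?U. \<Sum>u\<in>?W.
            if k \<otimes> l = u then (if h \<otimes> u = g then a h * (b k * c l) else 0) else 0)"
        proof (intro sum.cong refl)
          fix h k l assume "k \<in> ?T" "l \<in> ?U"
          then have "k \<otimes> l \<in> ?W" by blast
          then show "(if h \<otimes> (k \<otimes> l) = g then a h * (b k * c l) else 0) =
            (\<Sum>u\<in>?W. if k \<otimes> l = u then (if h \<otimes> u = g then a h * (b k * c l) else 0) else 0)"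
            by (subst sum.delta'[OF finW]) simp
        qed
        also have "\<dots> = (\<Sum>h\<in>?S. \<Sum>k\<in>?T. \<Sum>u\<in>?W. \<Sum>l\<in>?U.
            if k \<otimes> l = u then (if h \<otimes> u = g then a h * (b k * c l) else 0) else 0)"
          by (intro sum.cong refl sum.swap)
        also have "\<dots> = (\<Sum>h\<in>?S. \<Sum>u\<in>?W. \<Sum>k\<in>?T. \<Sum>l\<in>?U.
            if k \<otimes> l = u then (if h \<otimes> u = g then a h * (b k * c l) else 0) else 0)"
          by (intro sum.cong refl sum.swap)
        also have "\<dots> = (\<Sum>h\<in>?S. \<Sum>u\<in>?W. if h \<otimes> u = g then a h * (b \<otimes>\<^bsub>?A\<^esub> c) u else 0)"
          unfolding group_algebra_mult_superset[OF fin(2,3) order_refl order_refl]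
        proof (intro sum.cong refl)
          fix h u
          show "(\<Sum>k\<in>?T. \<Sum>l\<in>?U.
              if k \<otimes> l = u then (if h \<otimes> u = g then a h * (b k * c l) else 0) else 0) =
            (if h \<otimes> u = g then a h * (\<Sum>k\<in>?T. \<Sum>l\<in>?U. if k \<otimes> l = u then b k * c l else 0)
              else 0)"
            by (cases "h \<otimes> u = g") (auto simp: sum_distrib_left intro!: sum.cong sum.neutral)
        qed
        also have "\<dots> = (a \<otimes>\<^bsub>?A\<^esub> (b \<otimes>\<^bsub>?A\<^esub> c)) g"
          by (rule group_algebra_mult_superset[OF fin(1) finW order_refl
                group_algebra_mult_support, symmetric])
        finally show "(a \<otimes>\<^bsub>?A\<^esub> b \<otimes>\<^bsub>?A\<^esub> c) g = (a \<otimes>\<^bsub>?A\<^esub> (b \<otimes>\<^bsub>?A\<^esub> c)) g" .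
      qed
    qed (use mult_cl in auto)
  next
    fix a b c assume abc: "a \<in> carrier ?A" "b \<in> carrier ?A" "c \<in> carrier ?A"
    let ?S = "{g. a g \<noteq> 0} \<union> {g. b g \<noteq> 0}" and ?U = "{g. c g \<noteq> 0}"
    have fin: "finite ?S" "finite ?U" using abc by (auto simp: car)
    have sub: "{g. a g \<noteq> 0} \<subseteq> ?S" "{g. b g \<noteq> 0} \<subseteq> ?S" "{g. (a \<oplus>\<^bsub>?A\<^esub> b) g \<noteq> 0} \<subseteq> ?S"
      by (auto simp: add)
    show "(a \<oplus>\<^bsub>?A\<^esub> b) \<otimes>\<^bsub>?A\<^esub> c = a \<otimes>\<^bsub>?A\<^esub> c \<oplus>\<^bsub>?A\<^esub> b \<otimes>\<^bsub>?A\<^esub> c"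
      unfolding add[of "a \<otimes>\<^bsub>?A\<^esub> c"]
        group_algebra_mult_superset[OF fin sub(1) order_refl]
        group_algebra_mult_superset[OF fin sub(2) order_refl]
      by (rule ext, subst group_algebra_mult_superset[OF fin sub(3) order_refl])
         (auto simp: add sum.distrib[symmetric] algebra_simps intro!: sum.cong)
    show "c \<otimes>\<^bsub>?A\<^esub> (a \<oplus>\<^bsub>?A\<^esub> b) = c \<otimes>\<^bsub>?A\<^esub> a \<oplus>\<^bsub>?A\<^esub> c \<otimes>\<^bsub>?A\<^esub> b"
      unfolding add[of "c \<otimes>\<^bsub>?A\<^esub> a"]
        group_algebra_mult_superset[OF fin(2,1) order_refl sub(1)]
        group_algebra_mult_superset[OF fin(2,1) order_refl sub(2)]
      by (rule ext, subst group_algebra_mult_superset[OF fin(2,1) order_refl sub(3)])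
         (auto simp: add sum.distrib[symmetric] algebra_simps intro!: sum.cong)
  qed
qed


section \<open>Central irreducible idempotents\<close>

definition central_idempotent :: "('b, 'z) ring_scheme \<Rightarrow> 'b \<Rightarrow> bool" where
  "central_idempotent A e \<longleftrightarrow>
     e \<in> carrier A \<and> e \<otimes>\<^bsub>A\<^esub> e = e \<and> (\<forall>a\<in>carrier A. e \<otimes>\<^bsub>A\<^esub> a = a \<otimes>\<^bsub>A\<^esub> e)"

definition central_irreducible_idempotent :: "('b, 'z) ring_scheme \<Rightarrow> 'b \<Rightarrow> bool" where
  "central_irreducible_idempotent A e \<longleftrightarrow>
     central_idempotent A e \<and> e \<noteq> \<zero>\<^bsub>A\<^esub> \<and>
     \<not> (\<exists>e1 e2. central_idempotent A e1 \<and> central_idempotent A e2 \<and>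
          e1 \<noteq> \<zero>\<^bsub>A\<^esub> \<and> e2 \<noteq> \<zero>\<^bsub>A\<^esub> \<and>
          e1 \<otimes>\<^bsub>A\<^esub> e2 = \<zero>\<^bsub>A\<^esub> \<and> e2 \<otimes>\<^bsub>A\<^esub> e1 = \<zero>\<^bsub>A\<^esub> \<and>
          e = e1 \<oplus>\<^bsub>A\<^esub> e2)"


section \<open>Reciprocal polynomials and the factorization of $x^n - 1$\<close>

text \<open>
  \<^term>\<open>reflect_poly g\<close> is the reciprocal polynomial \<open>x\<^sup>d g(1/x)\<close> with \<open>d\<close> the degree of \<open>g\<close>.
  The following variant is \<open>x\<^sup>d g(1/x)\<close> for a prescribed \<open>d\<close> that is at least
  the degree of \<open>g\<close>.
\<close>

definition reciprocal_wrt :: "nat \<Rightarrow> 'a::comm_ring_1 poly \<Rightarrow> 'a poly" where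
  "reciprocal_wrt d g = (\<Sum>i\<le>d. monom (coeff g i) (d - i))"

definition monic_reciprocal :: "'a::field poly \<Rightarrow> 'a poly" where
  "monic_reciprocal g =
     Polynomial.smult (inverse (lead_coeff (reflect_poly g))) (reflect_poly g)"

definition auto_reciprocal :: "'a::field poly \<Rightarrow> bool" where
  "auto_reciprocal g \<longleftrightarrow> (\<exists>c. c \<noteq> 0 \<and> reflect_poly g = Polynomial.smult c g)"

text \<open>Only the values \<open>f 1, \<dots>, f (r + s)\<close> are relevant.\<close>

definition reciprocal_factorization ::
  "nat \<Rightarrow> nat \<Rightarrow> nat \<Rightarrow> (nat \<Rightarrow> 'a::field poly) \<Rightarrow> bool" where
  "reciprocal_factorization n r s f \<longleftrightarrow>
     monom 1 n - 1 =
       (\<Prod>j\<in>{1..r}. f j) * (\<Prod>j\<in>{r+1..r+s}. f j * monic_reciprocal (f j)) \<and>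
     (\<forall>j\<in>{1..r+s}. lead_coeff (f j) = 1 \<and> irreducible (f j)) \<and>
     (\<forall>j\<in>{r+1..r+s}. irreducible (monic_reciprocal (f j))) \<and>
     distinct (map f [1..<r+s+1] @ map (\<lambda>j. monic_reciprocal (f j)) [r+1..<r+s+1]) \<and>
     (\<forall>j\<in>{1..r}. auto_reciprocal (f j)) \<and>
     (\<forall>j\<in>{r+1..r+s}. \<not> auto_reciprocal (f j)) \<and>
     1 \<le> r \<and> f 1 = [:-1, 1:] \<and>
     (even n \<longrightarrow> 2 \<le> r \<and> f 2 = [:1, 1:])"


section \<open>The elements $e_f$\<close>

definition e_poly :: "nat \<Rightarrow> 'a::field poly \<Rightarrow> 'a poly" where
  "e_poly n g =
     Polynomial.smult (- (1 / of_nat n))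
       (reciprocal_wrt (degree g - 1) (pderiv (reflect_poly g)) * ((monom 1 n - 1) div g))"

definition poly_subst :: "('a::comm_ring_1, 'b, 'z) module_scheme \<Rightarrow> 'a poly \<Rightarrow> 'b \<Rightarrow> 'b" where
  "poly_subst A p u = (\<Oplus>\<^bsub>A\<^esub>i\<in>{..degree p}. coeff p i \<odot>\<^bsub>A\<^esub> (u [^]\<^bsub>A\<^esub> i))"

abbreviation dihedral_algebra :: "nat \<Rightarrow> ('a::field, int \<times> bool \<Rightarrow> 'a) module" where
  "dihedral_algebra n \<equiv> group_algebra (dihedral_group n)"

definition e_elem :: "nat \<Rightarrow> 'a::field poly \<Rightarrow> int \<times> bool \<Rightarrow> 'a" where
  "e_elem n g = poly_subst (dihedral_algebra n) (e_poly n g) (basis_elem (dihedral_x n))"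

text \<open>The elements \<open>(1 + y)/2\<close> and \<open>(1 - y)/2\<close>; used only when \<open>2\<close> is invertible.\<close>

definition half_plus :: "nat \<Rightarrow> int \<times> bool \<Rightarrow> 'a::field" where
  "half_plus n = (1 / 2) \<odot>\<^bsub>dihedral_algebra n\<^esub>
     (\<one>\<^bsub>dihedral_algebra n\<^esub> \<oplus>\<^bsub>dihedral_algebra n\<^esub> basis_elem dihedral_y)"

definition half_minus :: "nat \<Rightarrow> int \<times> bool \<Rightarrow> 'a::field" where
  "half_minus n = (1 / 2) \<odot>\<^bsub>dihedral_algebra n\<^esub>
     (\<one>\<^bsub>dihedral_algebra n\<^esub> \<ominus>\<^bsub>dihedral_algebra n\<^esub> basis_elem dihedral_y)"

end

theory Submission
  imports Defs "HOL-Number_Theory.Cong" "HOL-Computational_Algebra.Polynomial_Factorial"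
begin

text \<open>
  Every element of the dihedral group algebra is \<open>P(x) + Q(x) y\<close> with polynomials \<open>P\<close>, \<open>Q\<close> that
  are determined modulo \<open>x\<^sup>n - 1\<close>, and since \<open>y P(x) = P(x\<^sup>-\<^sup>1) y\<close> the product is
  \<open>(P + Q y) (P' + Q' y) = (P P' + Q \<sigma>(Q')) + (P Q' + Q \<sigma>(P')) y\<close>, where \<open>\<sigma>\<close> is the substitution
  of \<open>x\<^sup>n\<^sup>-\<^sup>1\<close> for \<open>x\<close>.  As \<open>x\<^sup>n - 1\<close> is a product of distinct irreducible polynomials, a
  congruence modulo \<open>x\<^sup>n - 1\<close> may be tested modulo each irreducible factor \<open>p\<close>, and \<open>\<sigma>\<close> carries
  congruences modulo \<open>p\<close> to congruences modulo \<open>p\<^sup>*\<close>.  Since \<open>x f' g = n x\<^sup>n - x f g'\<close> when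
  \<open>x\<^sup>n - 1 = f g\<close>, the polynomial \<open>e\<^sub>f\<close> is congruent to 1 modulo \<open>f\<close> and to 0 modulo \<open>g\<close>
  (lemmas \<open>e_poly_cong_1\<close> and \<open>e_poly_cong_0\<close>): it is the idempotent that the Chinese remainder
  theorem attaches to \<open>f\<close>.

  The irreducible factors fall into blocks, \<open>{f\<^sub>j}\<close> for \<open>j \<le> r\<close> and \<open>{f\<^sub>j, f\<^sub>j\<^sup>*}\<close> for \<open>j > r\<close>.
  The sum \<open>E\<close> of the \<open>e\<^sub>f\<close> over a block is fixed by \<open>\<sigma>\<close>, hence central.  The claim is that these
  \<open>E\<close>, split further by \<open>(1 \<plusminus> y)/2\<close> for the factors \<open>x \<mp> 1\<close> in odd characteristic, form a
  complete family of orthogonal primitive central idempotents; such a family always consists of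
  exactly the central irreducible idempotents
  (lemma \<open>central_irreducible_idempotents_eq_image\<close>), and the cardinalities follow because
  orthogonal nonzero idempotents are distinct.

  The point that carries the argument is primitivity (lemma \<open>block_idempotent_primitive\<close>).  If
  \<open>P + Q y\<close> is a central idempotent, then commuting with \<open>x\<close> and \<open>y\<close> and being idempotent give
  \<open>(x\<^sup>2 - 1) Q = 0\<close>, \<open>\<sigma>(P) = P\<close>, \<open>\<sigma>(Q) = Q\<close>, \<open>P\<^sup>2 + Q\<^sup>2 = P\<close> and \<open>2 P Q = Q\<close>.
  In a block whose factors do not divide \<open>x\<^sup>2 - 1\<close>, and in every block in characteristic 2, this forces
  \<open>Q = 0\<close> and \<open>P\<^sup>2 = P\<close>; so \<open>P\<close> is 0 or 1 modulo \<open>f\<^sub>j\<close>, and \<open>\<sigma>(P) = P\<close> transfers this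
  value to \<open>f\<^sub>j\<^sup>*\<close>.  In the blocks of \<open>x \<mp> 1\<close> in odd characteristic the element lies below
  \<open>(1 \<plusminus> y)/2\<close>, so \<open>Q = \<plusminus>P\<close> and \<open>2 P Q = Q\<close> leave \<open>P = 0\<close> or \<open>P = 1/2\<close>.
\<close>

section \<open>Complete families of primitive central idempotents\<close>

lemma central_idempotentD:
  assumes "central_idempotent A e"
  shows "e \<in> carrier A" "e \<otimes>\<^bsub>A\<^esub> e = e" "a \<in> carrier A \<Longrightarrow> e \<otimes>\<^bsub>A\<^esub> a = a \<otimes>\<^bsub>A\<^esub> e"
  using assms unfolding central_idempotent_def by blast+

lemma (in ring) central_idempotent_mult:
  assumes "central_idempotent R d" "central_idempotent R e"
  shows "central_idempotent R (d \<otimes> e)"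
  unfolding central_idempotent_def
proof (intro conjI ballI)
  have d: "d \<in> carrier R" "d \<otimes> d = d" and e: "e \<in> carrier R" "e \<otimes> e = e"
    and cd: "\<And>a. a \<in> carrier R \<Longrightarrow> d \<otimes> a = a \<otimes> d" and ce: "\<And>a. a \<in> carrier R \<Longrightarrow> e \<otimes> a = a \<otimes> e"
    using assms by (simp_all only: central_idempotentD)
  show "d \<otimes> e \<in> carrier R" using d e by simp
  have "d \<otimes> e \<otimes> (d \<otimes> e) = d \<otimes> (e \<otimes> d) \<otimes> e" using d e by (simp add: m_assoc)
  also have "\<dots> = (d \<otimes> d) \<otimes> (e \<otimes> e)"
    unfolding ce[OF d(1)] using d(1) e(1) by (simp only: m_assoc m_closed)
  finally show "d \<otimes> e \<otimes> (d \<otimes> e) = d \<otimes> e" using d e by simp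
  fix a assume a: "a \<in> carrier R"
  have "d \<otimes> e \<otimes> a = d \<otimes> a \<otimes> e" using d e a ce[of a] by (simp add: m_assoc)
  also have "\<dots> = a \<otimes> (d \<otimes> e)" using d e a cd[of a] by (simp add: m_assoc)
  finally show "d \<otimes> e \<otimes> a = a \<otimes> (d \<otimes> e)" .
qed

lemma (in ring) central_idempotent_diff:
  assumes "central_idempotent R d" "central_idempotent R e" "d \<otimes> e = d"
  shows "central_idempotent R (e \<ominus> d)" and "d \<otimes> (e \<ominus> d) = \<zero>" and "(e \<ominus> d) \<otimes> d = \<zero>"
    and "e = d \<oplus> (e \<ominus> d)"
proof -
  have d: "d \<in> carrier R" "d \<otimes> d = d" and e: "e \<in> carrier R" "e \<otimes> e = e"
    and cd: "\<And>a. a \<in> carrier R \<Longrightarrow> d \<otimes> a = a \<otimes> d" and ce: "\<And>a. a \<in> carrier R \<Longrightarrow> e \<otimes> a = a \<otimes> e"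
    using assms(1,2) by (simp_all only: central_idempotentD)
  have ed: "e \<otimes> d = d" using ce[OF d(1)] assms(3) by simp
  show 1: "d \<otimes> (e \<ominus> d) = \<zero>" "(e \<ominus> d) \<otimes> d = \<zero>"
    using d e ed assms(3) by (simp_all add: minus_eq r_distr l_distr r_minus l_minus r_neg)
  have "(e \<ominus> d) \<otimes> (e \<ominus> d) = e \<otimes> (e \<ominus> d) \<ominus> d \<otimes> (e \<ominus> d)"
    using d e by (simp add: minus_eq l_distr l_minus)
  also have "\<dots> = e \<ominus> d"
    unfolding 1 using d e ed by (simp add: minus_eq r_distr r_minus)
  finally have "(e \<ominus> d) \<otimes> (e \<ominus> d) = e \<ominus> d" .
  moreover have "(e \<ominus> d) \<otimes> a = a \<otimes> (e \<ominus> d)" if "a \<in> carrier R" for a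
    using that d e cd[of a] ce[of a] by (simp add: minus_eq l_distr r_distr l_minus r_minus)
  ultimately show "central_idempotent R (e \<ominus> d)"
    unfolding central_idempotent_def using minus_closed[OF e(1) d(1)] by blast
  show "e = d \<oplus> (e \<ominus> d)"
    using a_lcomm[OF d(1) e(1) a_inv_closed[OF d(1)]] d(1) e(1) by (simp add: minus_eq r_neg)
qed

text \<open>
  Completeness is formulated without a sum: only 0 is annihilated by all members of the family.
  A central irreducible idempotent \<open>e\<close> is then not annihilated by some \<open>g i\<close>, and the orthogonal
  decomposition \<open>e = g i e + (e - g i e)\<close> forces \<open>e = g i e\<close>; primitivity of \<open>g i\<close> gives
  \<open>e = g i\<close>.
\<close>

lemma (in ring) central_irreducible_idempotents_eq_image:
  assumes central: "\<And>i. i \<in> J \<Longrightarrow> central_idempotent R (g i)"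
    and nonzero: "\<And>i. i \<in> J \<Longrightarrow> g i \<noteq> \<zero>"
    and orth: "\<And>i k. i \<in> J \<Longrightarrow> k \<in> J \<Longrightarrow> i \<noteq> k \<Longrightarrow> g i \<otimes> g k = \<zero>"
    and compl: "\<And>u. u \<in> carrier R \<Longrightarrow> (\<And>i. i \<in> J \<Longrightarrow> g i \<otimes> u = \<zero>) \<Longrightarrow> u = \<zero>"
    and prim: "\<And>i u. i \<in> J \<Longrightarrow> central_idempotent R u \<Longrightarrow> g i \<otimes> u = u \<Longrightarrow> u = \<zero> \<or> u = g i"
  shows "{e. central_irreducible_idempotent R e} = g ` J" and "inj_on g J"
proof -
  have c: "g i \<in> carrier R" "g i \<otimes> g i = g i" if "i \<in> J" for i
    using central_idempotentD[OF central[OF that]] by blast+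
  have "central_irreducible_idempotent R (g i)" if i: "i \<in> J" for i
    unfolding central_irreducible_idempotent_def
  proof (intro conjI notI)
    show "central_idempotent R (g i)" by (rule central[OF i])
    show "g i = \<zero> \<Longrightarrow> False" using nonzero[OF i] by simp
    assume "\<exists>e1 e2. central_idempotent R e1 \<and> central_idempotent R e2 \<and>
          e1 \<noteq> \<zero> \<and> e2 \<noteq> \<zero> \<and> e1 \<otimes> e2 = \<zero> \<and> e2 \<otimes> e1 = \<zero> \<and> g i = e1 \<oplus> e2"
    then obtain e1 e2 where e: "central_idempotent R e1" "central_idempotent R e2" "e1 \<noteq> \<zero>" "e2 \<noteq> \<zero>"
      "e1 \<otimes> e2 = \<zero>" "e2 \<otimes> e1 = \<zero>" "g i = e1 \<oplus> e2" by blast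
    have d: "e1 \<in> carrier R" "e1 \<otimes> e1 = e1" "e2 \<in> carrier R" "e2 \<otimes> e2 = e2"
      using e by (simp_all only: central_idempotentD)
    have "g i \<otimes> e1 = e1" using d e by (simp add: l_distr)
    then have "e1 = g i" using prim[OF i e(1)] e by simp
    then have "e1 \<oplus> \<zero> = e1 \<oplus> e2" using e(7) d by simp
    then have "e2 = \<zero>" using d by (metis r_neg1 zero_closed)
    then show False using e by simp
  qed
  moreover have "e \<in> g ` J" if e: "central_irreducible_idempotent R e" for e
  proof -
    have ce: "central_idempotent R e" "e \<noteq> \<zero>"
      using e unfolding central_irreducible_idempotent_def by auto
    have ec: "e \<in> carrier R" "e \<otimes> e = e" using central_idempotentD[OF ce(1)] by blast+
    obtain i where i: "i \<in> J" "g i \<otimes> e \<noteq> \<zero>" using compl[OF ec(1)] ce(2) by blast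
    have w: "central_idempotent R (g i \<otimes> e)" by (rule central_idempotent_mult[OF central[OF i(1)]
        ce(1)])
    have we: "g i \<otimes> e \<otimes> e = g i \<otimes> e" using c[OF i(1)] ec by (simp add: m_assoc)
    note s = central_idempotent_diff[OF w ce(1) we]
    have "e \<ominus> g i \<otimes> e = \<zero>"
      using e s w i(2) unfolding central_irreducible_idempotent_def by blast
    then have "e = g i \<otimes> e" using s(4) c[OF i(1)] ec by simp
    then have "e = g i" using prim[OF i(1) ce(1)] ce(2) by simp
    then show ?thesis using i by blast
  qed
  ultimately show "{e. central_irreducible_idempotent R e} = g ` J" by blast
  show "inj_on g J"
  proof (rule inj_onI, rule ccontr)
    fix i k assume "i \<in> J" "k \<in> J" "g i = g k" "i \<noteq> k"
    then show False using orth[of i k] c(2)[of k] nonzero[of k] by simp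
  qed
qed

section \<open>Elements of the dihedral group algebra as pairs of polynomials\<close>

text \<open>
  The exponent \<open>n - 1\<close> stands for \<open>-1\<close>: modulo \<open>x\<^sup>n - 1\<close> this is the substitution of
  \<open>x\<^sup>-\<^sup>1\<close> for \<open>x\<close>, that is, conjugation by \<open>y\<close>.
\<close>

definition dih_flip :: "nat \<Rightarrow> 'a::field poly \<Rightarrow> 'a poly" where
  "dih_flip n P = pcompose P (monom 1 (n - 1))"

text \<open>
  The element \<open>P(x) + Q(x) y\<close>: as \<open>x\<close> has order \<open>n\<close>, its coefficients are those of the
  remainders of \<open>P\<close> and \<open>Q\<close> modulo \<open>x\<^sup>n - 1\<close>.
\<close>

definition dih_elem :: "nat \<Rightarrow> 'a::field poly \<Rightarrow> 'a poly \<Rightarrow> int \<times> bool \<Rightarrow> 'a" where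
  "dih_elem n P Q = (\<lambda>(i, b). if 0 \<le> i \<and> i < int n
     then coeff ((if b then Q else P) mod (monom 1 n - 1)) (nat i) else 0)"

lemma degree_cyc: "n > 0 \<Longrightarrow> degree (monom 1 n - 1 :: 'a::field poly) = n"
  unfolding diff_conv_add_uminus
  by (subst degree_add_eq_left) (auto simp: degree_monom_eq)

lemma cong_cyc_power: "[monom 1 (n * k) = (1 :: 'a::field poly)] (mod (monom 1 n - 1))"
proof -
  have "[monom 1 n = (1 :: 'a poly)] (mod (monom 1 n - 1))"
    by (simp add: cong_iff_dvd_diff)
  from cong_pow[OF this, of k] show ?thesis by (simp add: monom_power)
qed

lemma cong_cyc_monom:
  assumes "int k mod int n = int l mod int n"
  shows "[monom c k = (monom c l :: 'a::field poly)] (mod (monom 1 n - 1))"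
proof -
  have *: "[monom c k = (monom c (k mod n) :: 'a::field poly)] (mod (monom 1 n - 1))" for k
  proof -
    have "monom c k = monom c (k mod n) * monom 1 (n * (k div n))"
      by (simp add: mult_monom)
    also have "[\<dots> = monom c (k mod n) * 1] (mod (monom 1 n - 1))"
      by (intro cong_scalar_left cong_cyc_power)
    finally show ?thesis by simp
  qed
  have "k mod n = l mod n" using assms by (metis of_nat_eq_iff zmod_int)
  then show ?thesis using *[of k] *[of l] by (metis cong_sym cong_trans)
qed

lemma monom_mod_cyc:
  assumes "n > 0"
  shows "monom c k mod (monom 1 n - 1 :: 'a::field poly) = monom c (k mod n)"
proof -
  have "monom c k mod (monom 1 n - 1 :: 'a poly) = monom c (k mod n) mod (monom 1 n - 1)"
    using cong_cyc_monom[of k n "k mod n" c] by (simp add: cong_def zmod_int)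
  also have "\<dots> = monom c (k mod n)"
    using assms by (intro mod_poly_less) (simp add: degree_cyc, meson degree_monom_le
        le_less_trans mod_less_divisor)
  finally show ?thesis .
qed

text \<open>
  Identities that are additive in \<open>P(x) + Q(x) y\<close> only have to be checked on scalar multiples of
  group elements.
\<close>

lemma poly_pair_induct [case_names left right add]:
  assumes "\<And>c k. R (monom c k) 0" "\<And>c k. R 0 (monom c k)"
    "\<And>P Q P' Q'. R P Q \<Longrightarrow> R P' Q' \<Longrightarrow> R (P + P') (Q + Q')"
  shows "R P (Q :: 'a::comm_ring_1 poly)"
proof -
  have 0: "R 0 0" using assms(1)[of 0 0] by simp
  have "R (\<Sum>i\<in>S. monom (coeff P i) i) 0" if "finite S" for S
    using that by (induction S) (use 0 assms(1) assms(3)[of _ 0 _ 0] in auto)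
  then have P: "R P 0" using poly_as_sum_of_monoms[of P] by (metis finite_atMost)
  have "R 0 (\<Sum>i\<in>S. monom (coeff Q i) i)" if "finite S" for S
    using that by (induction S) (use 0 assms(2) assms(3)[of 0 _ 0] in auto)
  then have "R 0 Q" using poly_as_sum_of_monoms[of Q] by (metis finite_atMost)
  from assms(3)[OF P this] show ?thesis by simp
qed

lemma dih_flip_simps [simp]:
  "dih_flip n (P + Q) = dih_flip n P + dih_flip n Q"
  "dih_flip n (P - Q) = dih_flip n P - dih_flip n Q"
  "dih_flip n (- P) = - dih_flip n P"
  "dih_flip n (P * Q) = dih_flip n P * dih_flip n Q"
  "dih_flip n (smult c P) = smult c (dih_flip n P)"
  "dih_flip n 0 = 0" "dih_flip n 1 = 1"
  by (simp_all add: dih_flip_def pcompose_add pcompose_diff pcompose_mult pcompose_smult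
      pcompose_1 pcompose_uminus)

lemma dih_flip_monom [simp]: "dih_flip n (monom c k) = monom c (k * (n - 1))"
proof -
  have "dih_flip n (monom 1 k) = (monom 1 (k * (n - 1)) :: 'a poly)"
  proof (induction k)
    case (Suc k)
    have "dih_flip n (monom 1 (Suc k)) = dih_flip n (monom 1 1) * (dih_flip n (monom 1 k) :: 'a
        poly)"
      unfolding dih_flip_simps(4)[symmetric] by (simp add: mult_monom)
    also have "dih_flip n (monom 1 1) = (monom 1 (n - 1) :: 'a poly)"
      by (simp add: dih_flip_def monom_Suc pcompose_pCons pcompose_1)
    finally show ?case unfolding Suc by (simp add: mult_monom)
  qed (simp add: dih_flip_def pcompose_1)
  then have "smult c (dih_flip n (monom 1 k)) = smult c (monom 1 (k * (n - 1)))" by simp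
  then show ?thesis unfolding dih_flip_simps(5)[symmetric] by (simp add: smult_monom)
qed

lemma group_algebra_mult_delta:
  "(\<lambda>g. if g = u then c else 0) \<otimes>\<^bsub>group_algebra G\<^esub> (\<lambda>g. if g = v then d else 0) =
     (\<lambda>g. if g = u \<otimes>\<^bsub>G\<^esub> v then c * (d::'a::comm_ring_1) else 0)"
  by (rule ext, subst group_algebra_mult_superset[of "{u}" "{v}"]) auto

context
  fixes n :: nat
  assumes n: "n > 0"
begin

lemma dih_ring: "ring (dihedral_algebra n :: ('a::field, int \<times> bool \<Rightarrow> 'a) module)"
  by (rule group_algebra_ring[OF dihedral_group_group[OF n]])

lemma dih_elem_closed [simp]: "dih_elem n P Q \<in> carrier (dihedral_algebra n)"
proof -
  have "{g. dih_elem n P Q g \<noteq> 0} \<subseteq> carrier (dihedral_group n)"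
    by (auto simp: dih_elem_def dihedral_group_def split: if_splits)
  moreover have "finite (carrier (dihedral_group n))" by (simp add: dihedral_group_def)
  ultimately show ?thesis by (auto simp: group_algebra_def intro: finite_subset)
qed

lemma dih_elem_add:
  "dih_elem n P Q \<oplus>\<^bsub>dihedral_algebra n\<^esub> dih_elem n P' Q' = dih_elem n (P + P') (Q + Q')"
  by (auto simp: group_algebra_def dih_elem_def poly_mod_add_left fun_eq_iff)

lemma dih_elem_smult:
  "c \<odot>\<^bsub>dihedral_algebra n\<^esub> dih_elem n P Q = dih_elem n (smult c P) (smult c Q)"
  by (auto simp: group_algebra_def dih_elem_def mod_smult_left fun_eq_iff)

lemma dih_elem_zero: "\<zero>\<^bsub>dihedral_algebra n\<^esub> = dih_elem n 0 0"
  by (auto simp: group_algebra_def dih_elem_def fun_eq_iff)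

lemma dih_elem_eq_iff:
  "dih_elem n P Q = dih_elem n P' Q' \<longleftrightarrow>
     [P = P'] (mod (monom 1 n - 1)) \<and> [Q = Q'] (mod (monom 1 n - 1))" (is "?L \<longleftrightarrow> ?R")
proof
  assume ?R then show ?L by (auto simp: dih_elem_def cong_def fun_eq_iff)
next
  assume L: ?L
  have *: "U mod (monom 1 n - 1) = V mod (monom 1 n - 1)"
    if h: "\<And>i. i < n \<Longrightarrow> coeff (U mod (monom 1 n - 1)) i = coeff (V mod (monom 1 n - 1)) i" for U V
        :: "'a poly"
  proof (rule poly_eqI)
    fix i
    have nz: "(monom 1 n - 1 :: 'a poly) \<noteq> 0" using degree_cyc[OF n, where 'a='a] n by fastforce
    have "coeff (W mod (monom 1 n - 1)) i = 0" if "i \<ge> n" for W :: "'a poly"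
      using degree_mod_less[OF nz, of W] that degree_cyc[OF n, where 'a='a]
      by (metis coeff_0 coeff_eq_0 le_less_trans not_le order.strict_trans2)
    then show "coeff (U mod (monom 1 n - 1)) i = coeff (V mod (monom 1 n - 1)) i"
      using h by (cases "i < n") auto
  qed
  have "P mod (monom 1 n - 1) = P' mod (monom 1 n - 1)"
  proof (rule *)
    fix i assume "i < n"
    then show "coeff (P mod (monom 1 n - 1)) i = coeff (P' mod (monom 1 n - 1)) i"
      using fun_cong[OF L, of "(int i, False)"] by (simp add: dih_elem_def)
  qed
  moreover have "Q mod (monom 1 n - 1) = Q' mod (monom 1 n - 1)"
  proof (rule *)
    fix i assume "i < n"
    then show "coeff (Q mod (monom 1 n - 1)) i = coeff (Q' mod (monom 1 n - 1)) i"
      using fun_cong[OF L, of "(int i, True)"] by (simp add: dih_elem_def)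
  qed
  ultimately show ?R by (simp add: cong_def)
qed

lemma dih_elem_monom:
  "dih_elem n (monom c k) 0 = (\<lambda>g. if g = (int k mod int n, False) then c else 0)"
  "dih_elem n 0 (monom c k) = (\<lambda>g. if g = (int k mod int n, True) then c else 0)"
  by (auto simp: dih_elem_def monom_mod_cyc[OF n] fun_eq_iff n simp flip: of_nat_mod)

lemma dih_elem_surj:
  assumes "a \<in> carrier (dihedral_algebra n)"
  obtains P Q where "a = dih_elem n P Q"
proof
  have m: "(\<Sum>i<n. monom (h i) i) mod (monom 1 n - 1) = (\<Sum>i<n. monom (h i) i)" for h :: "nat \<Rightarrow> 'a"
  proof (rule mod_poly_less)
    have "degree (\<Sum>i<n. monom (h i) i) \<le> n - 1"
      by (rule degree_sum_le) (auto intro: order_trans[OF degree_monom_le])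
    then show "degree (\<Sum>i<n. monom (h i) i) < degree (monom 1 n - 1 :: 'a poly)"
      unfolding degree_cyc[OF n] using n by linarith
  qed
  have c: "coeff (\<Sum>i<n. monom (h i) i) k = (if k < n then h k else 0)" for h :: "nat \<Rightarrow> 'a" and k
    by (simp add: coeff_sum)
  show "a = dih_elem n (\<Sum>i<n. monom (a (int i, False)) i) (\<Sum>i<n. monom (a (int i, True)) i)"
  proof
    fix g :: "int \<times> bool"
    obtain i b where g: "g = (i, b)" by (cases g)
    have "a g = 0" if "\<not> (0 \<le> i \<and> i < int n)"
      using assms that by (auto simp: group_algebra_def dihedral_group_def g)
    then show "a g = dih_elem n (\<Sum>i<n. monom (a (int i, False)) i) (\<Sum>i<n. monom (a (int i, True))
        i) g"
      by (cases b) (auto simp: dih_elem_def g m c nat_less_iff)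
  qed
qed

lemma dihedral_group_mult:
  "(int k mod int n, b) \<otimes>\<^bsub>dihedral_group n\<^esub> (int l mod int n, c) =
     ((if b then int k - int l else int k + int l) mod int n, b \<noteq> c)"
  by (simp add: dihedral_group_def mod_simps)

text \<open>
  Both sides are biadditive, so the product may be computed on group elements, where it is the
  relation \<open>y x\<^sup>l = x\<^sup>-\<^sup>l y\<close>.
\<close>

lemma dih_elem_mult:
  "dih_elem n P Q \<otimes>\<^bsub>dihedral_algebra n\<^esub> dih_elem n P' Q' =
   dih_elem n (P * P' + Q * dih_flip n Q') (P * Q' + Q * dih_flip n (P' :: 'a::field poly))"
proof -
  interpret A: ring "dihedral_algebra n :: ('a, int \<times> bool \<Rightarrow> 'a) module" by (rule dih_ring)
  have flip: "(int k + int (l * (n - 1))) mod int n = (int k - int l) mod int n" for k l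
  proof -
    have "int k + int (l * (n - 1)) = int k - int l + int n * int l"
      using n by (simp add: of_nat_diff algebra_simps)
    then show ?thesis by (simp only: mod_mult_self2)
  qed
  show ?thesis
  proof (induction P Q rule: poly_pair_induct)
    case (left c k)
    show ?case
    proof (induction P' Q' rule: poly_pair_induct)
      case (add P1 Q1 P2 Q2)
      have "dih_elem n (monom c k) 0 \<otimes>\<^bsub>dihedral_algebra n\<^esub> dih_elem n (P1 + P2) (Q1 + Q2) =
          dih_elem n (monom c k) 0 \<otimes>\<^bsub>dihedral_algebra n\<^esub> dih_elem n P1 Q1 \<oplus>\<^bsub>dihedral_algebra n\<^esub>
          dih_elem n (monom c k) 0 \<otimes>\<^bsub>dihedral_algebra n\<^esub> dih_elem n P2 Q2"
        by (simp add: dih_elem_add[symmetric] A.r_distr)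
      then show ?case unfolding add dih_elem_add by (simp add: algebra_simps)
    qed (simp_all add: dih_elem_monom group_algebra_mult_delta mult_monom dihedral_group_mult)
  next
    case (right c k)
    show ?case
    proof (induction P' Q' rule: poly_pair_induct)
      case (add P1 Q1 P2 Q2)
      have "dih_elem n 0 (monom c k) \<otimes>\<^bsub>dihedral_algebra n\<^esub> dih_elem n (P1 + P2) (Q1 + Q2) =
          dih_elem n 0 (monom c k) \<otimes>\<^bsub>dihedral_algebra n\<^esub> dih_elem n P1 Q1 \<oplus>\<^bsub>dihedral_algebra n\<^esub>
          dih_elem n 0 (monom c k) \<otimes>\<^bsub>dihedral_algebra n\<^esub> dih_elem n P2 Q2"
        by (simp add: dih_elem_add[symmetric] A.r_distr)
      then show ?case unfolding add dih_elem_add by (simp add: algebra_simps)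
    qed (simp_all add: dih_elem_monom group_algebra_mult_delta mult_monom flip[unfolded
        One_nat_def of_nat_mult] dihedral_group_mult)
  next
    case (add P Q P2 Q2)
    have "dih_elem n (P + P2) (Q + Q2) \<otimes>\<^bsub>dihedral_algebra n\<^esub> dih_elem n P' Q' =
       dih_elem n P Q \<otimes>\<^bsub>dihedral_algebra n\<^esub> dih_elem n P' Q' \<oplus>\<^bsub>dihedral_algebra n\<^esub>
       dih_elem n P2 Q2 \<otimes>\<^bsub>dihedral_algebra n\<^esub> dih_elem n P' Q'"
      by (simp add: dih_elem_add[symmetric] A.l_distr)
    then show ?case unfolding add dih_elem_add by (simp add: algebra_simps)
  qed
qed

end

context
  fixes n :: nat
  assumes n: "n > 0"
begin

lemma dih_elem_one: "\<one>\<^bsub>dihedral_algebra n\<^esub> = dih_elem n 1 (0 :: 'a::field poly)"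
  using dih_elem_monom(1)[OF n, of "1::'a" 0]
  by (simp add: group_algebra_def dihedral_group_def fun_eq_iff)

lemma basis_elem_dihedral_y: "basis_elem dihedral_y = dih_elem n 0 (1 :: 'a::field poly)"
  using dih_elem_monom(2)[OF n, of "1::'a" 0]
  by (simp add: basis_elem_def dihedral_y_def)

lemma dih_elem_minus:
  "\<ominus>\<^bsub>dihedral_algebra n\<^esub> dih_elem n P Q = dih_elem n (- P) (- Q :: 'a::field poly)"
proof -
  interpret A: ring "dihedral_algebra n :: ('a, int \<times> bool \<Rightarrow> 'a) module" by (rule dih_ring[OF n])
  show ?thesis
    by (rule A.minus_equality) (simp_all add: n dih_elem_add dih_elem_zero)
qed

lemma half_plus_eq: "half_plus n = dih_elem n [:1/2:] [:1/2 :: 'a::field:]"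
  by (simp add: half_plus_def dih_elem_one basis_elem_dihedral_y dih_elem_add n dih_elem_smult
      smult_one)

lemma half_minus_eq: "half_minus n = dih_elem n [:1/2:] [:- (1/2) :: 'a::field:]"
  by (simp add: half_minus_def a_minus_def dih_elem_minus dih_elem_one basis_elem_dihedral_y
      dih_elem_add n dih_elem_smult smult_one)

lemma poly_subst_dihedral_x:
  "poly_subst (dihedral_algebra n) p (basis_elem (dihedral_x n)) = dih_elem n p (0 :: 'a::field
      poly)"
proof -
  interpret A: ring "dihedral_algebra n :: ('a, int \<times> bool \<Rightarrow> 'a) module" by (rule dih_ring[OF n])
  have x: "basis_elem (dihedral_x n) = dih_elem n (monom 1 1) (0 :: 'a poly)"
    using dih_elem_monom(1)[OF n, of "1::'a" 1] by (simp add: basis_elem_def dihedral_x_def)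
  have pow: "dih_elem n (monom 1 1) (0 :: 'a poly) [^]\<^bsub>dihedral_algebra n\<^esub> i = dih_elem n (monom 1
      i) 0" for i :: nat
    by (induction i) (simp_all add: dih_elem_one dih_elem_mult[OF n] mult_monom)
  have sum: "(\<Oplus>\<^bsub>dihedral_algebra n\<^esub>i\<in>S. dih_elem n (h i) (0 :: 'a poly)) = dih_elem n (\<Sum>i\<in>S. h i) 0"
    if "finite S" for S :: "nat set" and h
    using that by (induction S) (simp_all add: dih_elem_zero dih_elem_add Pi_def n)
  show ?thesis
    unfolding poly_subst_def x pow dih_elem_smult
    by (simp add: dih_elem_smult n sum smult_monom poly_as_sum_of_monoms)
qed

end

section \<open>Reciprocal polynomials and the idempotents $e_f$\<close>

lemma reflect_poly_as_sum:
  "reflect_poly p = (\<Sum>i\<le>degree p. monom (coeff p i) (degree p - i))"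
proof -
  have "reflect_poly p = (\<Sum>k\<le>degree p. monom (coeff (reflect_poly p) k) k)"
    by (rule poly_as_sum_of_monoms'[symmetric, OF degree_reflect_poly_le])
  also have "\<dots> = (\<Sum>i\<le>degree p. monom (coeff p i) (degree p - i))"
    by (rule sum.reindex_bij_witness[of _ "\<lambda>i. degree p - i" "\<lambda>i. degree p - i"])
       (auto simp: coeff_reflect_poly)
  finally show ?thesis .
qed

lemma dih_flip_sum: "dih_flip n (\<Sum>i\<in>S. h i) = (\<Sum>i\<in>S. dih_flip n (h i))"
  by (simp add: dih_flip_def pcompose_sum)

text \<open>
  Modulo \<open>x\<^sup>n - 1\<close> the variable is invertible, and \<open>p(x\<^sup>-\<^sup>1)\<close> differs from the reciprocal
  polynomial only by the unit \<open>x\<^sup>-\<^sup>d\<close>, where \<open>d\<close> is the degree of \<open>p\<close>.  Writing the unit as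
  \<open>x\<^sup>(\<^sup>n\<^sup>-\<^sup>1\<^sup>)\<^sup>d\<close> avoids negative exponents.
\<close>

lemma dih_flip_cong_reflect_poly:
  assumes n: "n > 0"
  shows "[dih_flip n p = monom 1 ((n - 1) * degree p) * reflect_poly p] (mod (monom 1 n - 1 ::
      'a::field poly))"
proof -
  let ?d = "degree p"
  have "dih_flip n p = (\<Sum>i\<le>?d. monom (coeff p i) (i * (n - 1)))"
    by (subst poly_as_sum_of_monoms[of p, symmetric]) (simp only: dih_flip_sum dih_flip_monom)
  also have "[\<dots> = (\<Sum>i\<le>?d. monom (coeff p i) ((n - 1) * ?d + (?d - i)))] (mod (monom 1 n - 1))"
  proof (rule cong_sum, rule cong_cyc_monom)
    fix i assume "i \<in> {..?d}"
    then obtain e where e: "?d = i + e" by (auto simp: le_iff_add)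
    obtain k where k: "n = Suc k" using n by (cases n) auto
    have "int ((n - 1) * ?d + (?d - i)) = int (i * (n - 1)) + int n * int e"
      unfolding e by (simp add: k algebra_simps)
    then show "int (i * (n - 1)) mod int n = int ((n - 1) * ?d + (?d - i)) mod int n"
      by (simp only: mod_mult_self2)
  qed
  also have "(\<Sum>i\<le>?d. monom (coeff p i) ((n - 1) * ?d + (?d - i))) =
      monom 1 ((n - 1) * ?d) * reflect_poly p"
    unfolding reflect_poly_as_sum sum_distrib_left by (simp add: mult_monom)
  finally show ?thesis .
qed

text \<open>
  From \<open>p\<^sup>*(x) = x\<^sup>d p(1/x)\<close> one gets \<open>(p\<^sup>*)'(x) = d x\<^sup>d\<^sup>-\<^sup>1 p(1/x) - x\<^sup>d\<^sup>-\<^sup>2 p'(1/x)\<close>;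
  taking reciprocals with respect to \<open>d - 1\<close> removes every reciprocal from the definition of \<open>e\<^sub>p\<close>.
\<close>

lemma reciprocal_wrt_pderiv_reflect_poly:
  assumes "degree p > 0"
  shows "reciprocal_wrt (degree p - 1) (pderiv (reflect_poly p)) =
    of_nat (degree p) * p - monom 1 1 * pderiv (p :: 'a::field poly)"
proof (rule poly_eqI)
  fix j
  let ?d = "degree p"
  have *: "coeff (reciprocal_wrt D q) j = (if j \<le> D then coeff q (D - j) else 0)" for D and q ::
      "'a poly"
  proof -
    have "coeff (reciprocal_wrt D q) j = (\<Sum>i\<le>D. if D - i = j then coeff q i else 0)"
      by (simp add: reciprocal_wrt_def coeff_sum)
    also have "\<dots> = (\<Sum>i\<le>D. if i = D - j then (if j \<le> D then coeff q (D - j) else 0) else 0)"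
      by (intro sum.cong) auto
    finally show ?thesis by simp
  qed
  have X: "coeff (monom 1 1 * pderiv p) j = of_nat j * coeff p j"
    by (cases j) (simp_all add: monom_Suc coeff_pderiv coeff_pCons)
  show "coeff (reciprocal_wrt (?d - 1) (pderiv (reflect_poly p))) j =
      coeff (of_nat ?d * p - monom 1 1 * pderiv p) j"
  proof (cases "j < ?d")
    case True
    then have "Suc (?d - 1 - j) = ?d - j" "j \<le> ?d - 1" "?d - (?d - j) = j" "\<not> ?d < ?d - j" by auto
    then show ?thesis using True
      by (simp add: * X coeff_pderiv coeff_reflect_poly of_nat_poly of_nat_diff left_diff_distrib
          del: diff_diff_left One_nat_def)
  next
    case False
    then have "\<not> j \<le> ?d - 1" using assms by simp
    moreover have "of_nat ?d * coeff p j = of_nat j * coeff p j"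
      using False by (cases "j = ?d") (simp_all add: coeff_eq_0)
    ultimately show ?thesis by (simp add: * X of_nat_poly del: One_nat_def)
  qed
qed

lemma e_poly_eq:
  assumes "degree p > 0"
  shows "e_poly n p = smult (1 / of_nat n)
    (monom 1 1 * pderiv p * ((monom 1 n - 1) div p) - of_nat (degree p) * (p * ((monom 1 n - 1)
        div p)) :: 'a::field poly)"
  unfolding e_poly_def reciprocal_wrt_pderiv_reflect_poly[OF assms]
  by (simp add: algebra_simps smult_diff_right)

text \<open>
  Write \<open>x\<^sup>n - 1 = p q\<close>.  Differentiating and multiplying by \<open>x\<close> gives
  \<open>x p' q = n x\<^sup>n - x p q'\<close>, which is \<open>n\<close> modulo \<open>p\<close>.
\<close>

lemma e_poly_cong_1:
  fixes p :: "'a::field poly"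
  assumes "degree p > 0" "p dvd monom 1 n - 1" "(of_nat n :: 'a) \<noteq> 0"
  shows "[e_poly n p = 1] (mod p)"
proof -
  let ?m = "monom 1 n - 1 :: 'a poly"
  define q where "q = ?m div p"
  have m: "?m = p * q" using assms(2) by (simp add: q_def)
  have "n > 0" using assms(3) by (cases n) auto
  then have "monom 1 1 * pderiv ?m = of_nat n * (?m + 1)"
    by (cases n) (simp_all add: pderiv_diff pderiv_monom mult_monom of_nat_poly smult_monom del:
        of_nat_Suc)
  then have E: "monom 1 1 * pderiv p * q = of_nat n * (p * q + 1) - p * (monom 1 1 * pderiv q)"
    unfolding m pderiv_mult by (simp add: algebra_simps)
  have "e_poly n p = smult (1 / of_nat n) (of_nat n + p * (of_nat n * q - monom 1 1 * pderiv q -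
      of_nat (degree p) * q))"
    unfolding e_poly_eq[OF assms(1)] q_def[symmetric] E by (simp add: algebra_simps)
  also have "\<dots> = 1 + p * smult (1 / of_nat n) (of_nat n * q - monom 1 1 * pderiv q - of_nat
      (degree p) * q)"
    using assms(3) by (simp add: smult_add_right of_nat_poly one_pCons)
  finally have "e_poly n p - 1 = p * smult (1 / of_nat n) (of_nat n * q - monom 1 1 * pderiv q -
      of_nat (degree p) * q)"
    by simp
  then show ?thesis unfolding cong_iff_dvd_diff by (metis dvd_triv_left)
qed

lemma e_poly_cong_0:
  assumes "degree p > 0" "q dvd (monom 1 n - 1) div p"
  shows "[e_poly n p = (0 :: 'a::field poly)] (mod q)"
  unfolding cong_0_iff e_poly_eq[OF assms(1)]
  by (intro dvd_smult dvd_diff dvd_mult assms)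

lemma prod_prime_elems_dvd:
  fixes P :: "'a::field poly"
  assumes "finite F" "\<And>p. p \<in> F \<Longrightarrow> prime_elem p" "\<And>p q. p \<in> F \<Longrightarrow> q \<in> F \<Longrightarrow> p \<noteq> q \<Longrightarrow> \<not> p dvd q"
    and "\<And>p. p \<in> F \<Longrightarrow> p dvd P"
  shows "\<Prod>F dvd P"
  using assms
proof (induction F)
  case (insert p F)
  then obtain R where R: "P = \<Prod>F * R" by (metis dvdE insertCI)
  have "\<not> p dvd \<Prod>G" if "finite G" "G \<subseteq> F" for G
    using that
  proof (induction G)
    case empty
    show ?case using insert.prems(1)[of p] by (simp add: prime_elem_def)
  next
    case (insert q G)
    then have "\<not> p dvd q" using insert.prems insert.hyps \<open>p \<notin> F\<close> \<open>\<And>p' q. p' \<in> insert p F \<Longrightarrow> q \<in>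
        insert p F \<Longrightarrow> p' \<noteq> q \<Longrightarrow> \<not> p' dvd q\<close>[of p q] by auto
    then show ?case using insert \<open>\<And>p'. p' \<in> insert p F \<Longrightarrow> prime_elem p'\<close>[of p]
      by (simp add: prime_elem_dvd_mult_iff)
  qed
  then have "\<not> p dvd \<Prod>F" using insert.hyps by simp
  then have "p dvd R" using insert.prems(1)[of p] insert.prems(3)[of p] R
    by (auto simp: prime_elem_dvd_mult_iff)
  then show ?case using insert.hyps R by (auto simp: mult.commute intro: mult_dvd_mono)
qed simp

lemma monic_irreducible_dvd_imp_eq:
  fixes p q :: "'a::field poly"
  assumes "p dvd q" "irreducible p" "irreducible q" "lead_coeff p = 1" "lead_coeff q = 1"
  shows "p = q"
proof -
  obtain c where c: "q = p * c" using assms(1) by (elim dvdE)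
  have "is_unit c" using irreducibleD[OF assms(3) c] assms(2) irreducible_not_unit by blast
  then obtain a where a: "c = [:a:]" by (auto simp: is_unit_poly_iff)
  have "lead_coeff c = 1" using lead_coeff_mult[of p c] assms(4,5) c by simp
  then have "a = 1" using a by simp
  then show ?thesis using c a by simp
qed

lemma lead_coeff_monic_reciprocal: "p \<noteq> 0 \<Longrightarrow> lead_coeff (monic_reciprocal p) = 1"
  by (simp add: monic_reciprocal_def)

lemma monic_reciprocal_auto:
  assumes "auto_reciprocal p" "lead_coeff p = 1"
  shows "monic_reciprocal p = p"
  using assms by (auto simp: auto_reciprocal_def monic_reciprocal_def)

lemma monic_reciprocal_monic_reciprocal:
  assumes "coeff p 0 \<noteq> 0" "lead_coeff p = 1"
  shows "monic_reciprocal (monic_reciprocal p) = p"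
proof -
  have "p \<noteq> 0" using assms by auto
  moreover from this have "coeff (reflect_poly p) (degree p) \<noteq> 0"
    using assms by (simp add: coeff_reflect_poly)
  ultimately show ?thesis using assms
    by (simp add: monic_reciprocal_def reflect_poly_smult)
qed

text \<open>
  The substitution \<open>x \<mapsto> x\<^sup>-\<^sup>1\<close> turns multiples of \<open>p\<close> into multiples of the reciprocal of
  \<open>p\<close>, up to multiples of \<open>x\<^sup>n - 1\<close>.
\<close>

lemma dih_flip_cong_monic_reciprocal:
  assumes "n > 0" "p \<noteq> 0" "monic_reciprocal p dvd monom 1 n - 1" "[P = Q] (mod p)"
  shows "[dih_flip n P = dih_flip n (Q :: 'a::field poly)] (mod monic_reciprocal p)"
proof -
  have "monic_reciprocal p dvd reflect_poly p"
    using assms(2) by (simp add: monic_reciprocal_def smult_dvd_iff)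
  then have "monic_reciprocal p dvd dih_flip n p"
    using cong_dvd_iff[OF cong_dvd_modulus[OF dih_flip_cong_reflect_poly[OF assms(1), of p]
        assms(3)]]
    by (simp add: cong_dvd_iff)
  moreover have "dih_flip n p dvd dih_flip n P - dih_flip n Q"
    using assms(4) unfolding cong_iff_dvd_diff
    by (metis dih_flip_simps(2,4) dvd_def)
  ultimately show ?thesis unfolding cong_iff_dvd_diff by (rule dvd_trans)
qed

section \<open>Blocks of irreducible factors\<close>

locale dihedral_factorization =
  fixes n r s \<epsilon> :: nat and f :: "nat \<Rightarrow> 'a::field poly"
  assumes n_pos: "n > 0"
    and n_nonzero: "(of_nat n :: 'a) \<noteq> 0"
    and factorization: "reciprocal_factorization n r s f"
    and eps: "\<epsilon> = (if (2::'a) = 0 then 0 else if odd n then 1 else 2)"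
begin

definition cyc :: "'a poly" where "cyc = monom 1 n - 1"

text \<open>
  The orbits of the irreducible factors under \<open>p \<mapsto> p\<^sup>*\<close>.
\<close>

definition block :: "nat \<Rightarrow> 'a poly set" where
  "block j = (if j \<le> r then {f j} else {f j, monic_reciprocal (f j)})"

definition factors :: "'a poly set" where "factors = (\<Union>j\<in>{1..r+s}. block j)"

text \<open>
  Congruent to 1 modulo the members of the block and to 0 modulo all other irreducible factors; see
  \<open>block_poly_cong\<close> below.
\<close>

definition block_poly :: "nat \<Rightarrow> 'a poly" where
  "block_poly j = (if j \<le> r then e_poly n (f j) else e_poly n (f j) + e_poly n (monic_reciprocal
      (f j)))"

lemma factors_eq: "factors = f ` {1..r+s} \<union> (\<lambda>j. monic_reciprocal (f j)) ` {r+1..r+s}"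
proof (intro equalityI subsetI)
  fix p assume "p \<in> f ` {1..r+s} \<union> (\<lambda>j. monic_reciprocal (f j)) ` {r+1..r+s}"
  then consider j where "j \<in> {1..r+s}" "p = f j" | j where "j \<in> {r+1..r+s}" "p = monic_reciprocal
      (f j)"
    by blast
  then have "\<exists>j\<in>{1..r+s}. p \<in> block j"
  proof cases
    case (1 j)
    then show ?thesis by (intro bexI[of _ j]) (auto simp: block_def)
  next
    case (2 j)
    then show ?thesis by (intro bexI[of _ j]) (auto simp: block_def)
  qed
  then show "p \<in> factors" by (simp add: factors_def)
qed (auto simp: factors_def block_def split: if_splits)

lemma distinct_factors:
  "inj_on f {1..r+s}" "inj_on (\<lambda>j. monic_reciprocal (f j)) {r+1..r+s}"
  "f ` {1..r+s} \<inter> (\<lambda>j. monic_reciprocal (f j)) ` {r+1..r+s} = {}"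
proof -
  have "distinct (map f [1..<r+s+1] @ map (\<lambda>j. monic_reciprocal (f j)) [r+1..<r+s+1])"
    using factorization unfolding reciprocal_factorization_def by blast
  moreover have "set [1..<r+s+1] = {1..r+s}" "set [r+1..<r+s+1] = {r+1..r+s}" by auto
  ultimately show "inj_on f {1..r+s}" "inj_on (\<lambda>j. monic_reciprocal (f j)) {r+1..r+s}"
    "f ` {1..r+s} \<inter> (\<lambda>j. monic_reciprocal (f j)) ` {r+1..r+s} = {}"
    unfolding distinct_append distinct_map set_map by simp_all
qed

lemma f_neq_monic_reciprocal:
  assumes "i \<in> {1..r+s}" "j \<in> {r+1..r+s}"
  shows "f i \<noteq> monic_reciprocal (f j)"
proof
  assume "f i = monic_reciprocal (f j)"
  then have "f i \<in> f ` {1..r+s} \<inter> (\<lambda>j. monic_reciprocal (f j)) ` {r+1..r+s}"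
    using assms by blast
  then show False unfolding distinct_factors(3) by blast
qed

lemma cyc_eq_prod: "cyc = \<Prod>factors"
proof -
  have "cyc = (\<Prod>j\<in>{1..r}. f j) * (\<Prod>j\<in>{r+1..r+s}. f j * monic_reciprocal (f j))"
    using factorization unfolding reciprocal_factorization_def cyc_def by blast
  also have "\<dots> = ((\<Prod>j\<in>{1..r}. f j) * (\<Prod>j\<in>{r+1..r+s}. f j)) * (\<Prod>j\<in>{r+1..r+s}. monic_reciprocal (f
      j))"
    by (simp add: prod.distrib mult.assoc)
  also have "(\<Prod>j\<in>{1..r}. f j) * (\<Prod>j\<in>{r+1..r+s}. f j) = (\<Prod>j\<in>{1..r+s}. f j)"
    by (subst prod.union_disjoint[symmetric]) (auto intro!: prod.cong)
  also have "\<dots> = \<Prod>(f ` {1..r+s})"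
    using distinct_factors(1) by (simp add: prod.reindex)
  also have "(\<Prod>j\<in>{r+1..r+s}. monic_reciprocal (f j)) = \<Prod>((\<lambda>j. monic_reciprocal (f j)) ` {r+1..r+s})"
    using prod.reindex[OF distinct_factors(2), of "\<lambda>x. x"] by (simp add: o_def)
  finally show ?thesis unfolding factors_eq
    using distinct_factors(3) by (subst prod.union_disjoint) auto
qed

lemma finite_factors: "finite factors" by (simp add: factors_eq)

lemma factor_properties:
  assumes "p \<in> factors"
  shows "irreducible p" "prime_elem p" "lead_coeff p = 1" "p dvd cyc" "degree p > 0" "coeff p 0 \<noteq>
      0" "p \<noteq> 0"
proof -
  have *: "lead_coeff (f j) = 1" "irreducible (f j)" if "j \<in> {1..r+s}" for j
    using factorization that unfolding reciprocal_factorization_def by blast+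
  have **: "irreducible (monic_reciprocal (f j))" "lead_coeff (monic_reciprocal (f j)) = 1" if "j
      \<in> {r+1..r+s}" for j
  proof -
    show "irreducible (monic_reciprocal (f j))"
      using factorization that unfolding reciprocal_factorization_def by blast
    have "f j \<noteq> 0" using *[of j] that by auto
    then show "lead_coeff (monic_reciprocal (f j)) = 1" by (rule lead_coeff_monic_reciprocal)
  qed
  show i: "irreducible p" and "lead_coeff p = 1" using assms * ** unfolding factors_eq by auto
  then show "prime_elem p" by (simp add: field_poly_irreducible_imp_prime)
  show "p \<noteq> 0" using i by auto
  show d: "p dvd cyc" unfolding cyc_eq_prod by (rule dvd_prodI[OF finite_factors assms, of "\<lambda>x.
      x", simplified])
  show "degree p > 0"
    using irreducible_not_unit[OF i] \<open>p \<noteq> 0\<close> is_unit_iff_degree[of p] by auto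
  obtain q where q: "cyc = p * q" using d by (elim dvdE)
  have "coeff cyc 0 = - 1" using n_pos by (simp add: cyc_def)
  then show "coeff p 0 \<noteq> 0" unfolding q by (auto simp: coeff_mult)
qed

lemma factor_not_dvd:
  assumes "p \<in> factors" "q \<in> factors" "p \<noteq> q"
  shows "\<not> p dvd q"
  using monic_irreducible_dvd_imp_eq[of p q] factor_properties[OF assms(1)] factor_properties[OF
      assms(2)] assms(3) by blast

text \<open>
  The injective half of the Chinese remainder theorem; it reduces all identities in the group
      algebra
  to residues modulo the irreducible factors.
\<close>

lemma cong_cyc_iff: "[P = Q] (mod cyc) \<longleftrightarrow> (\<forall>p\<in>factors. [P = Q] (mod p))"
proof
  assume "[P = Q] (mod cyc)"
  then show "\<forall>p\<in>factors. [P = Q] (mod p)" using factor_properties(4) cong_dvd_modulus by blast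
next
  assume "\<forall>p\<in>factors. [P = Q] (mod p)"
  then show "[P = Q] (mod cyc)"
    unfolding cong_iff_dvd_diff cyc_eq_prod
    using prod_prime_elems_dvd[OF finite_factors factor_properties(2) factor_not_dvd] by blast
qed

lemma block_subset: "j \<in> {1..r+s} \<Longrightarrow> block j \<subseteq> factors"
  by (auto simp: factors_def)

lemma block_disjoint:
  assumes "i \<in> {1..r+s}" "j \<in> {1..r+s}" "p \<in> block i" "p \<in> block j"
  shows "i = j"
proof -
  have a: "f i = f j \<Longrightarrow> i = j" using assms distinct_factors(1) by (auto dest: inj_onD)
  have b: "\<not> i \<le> r \<Longrightarrow> \<not> j \<le> r \<Longrightarrow> monic_reciprocal (f i) = monic_reciprocal (f j) \<Longrightarrow> i = j"
    using inj_onD[OF distinct_factors(2), of i j] assms by auto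
  have c: "f k \<noteq> monic_reciprocal (f l)" if "k \<in> {1..r+s}" "l \<in> {1..r+s}" "\<not> l \<le> r" for k l
    by (rule f_neq_monic_reciprocal) (use that in auto)
  show ?thesis using assms(3,4) a b c[of i j] c[of j i] assms(1,2)
    by (auto simp: block_def split: if_splits)
qed

lemma e_poly_cong:
  assumes "p \<in> factors" "q \<in> factors"
  shows "[e_poly n p = (if p = q then 1 else 0)] (mod q)"
proof (cases "p = q")
  case True
  then show ?thesis using e_poly_cong_1[of p n] factor_properties[OF assms(1)] n_nonzero by (simp
      add: cyc_def)
next
  case False
  have "cyc = p * (cyc div p)" using factor_properties(4)[OF assms(1)] by simp
  then have "q dvd p * (cyc div p)" using factor_properties(4)[OF assms(2)] by simp
  then have "q dvd cyc div p"
    using factor_not_dvd[OF assms(2,1)] False factor_properties(2)[OF assms(2)] by (auto simp: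
        prime_elem_dvd_mult_iff)
  then show ?thesis using e_poly_cong_0[OF factor_properties(5)[OF assms(1)], of q n] False by
      (simp add: cyc_def)
qed

lemma block_poly_cong:
  assumes "j \<in> {1..r+s}" "p \<in> factors"
  shows "[block_poly j = (if p \<in> block j then 1 else 0)] (mod p)"
proof (cases "j \<le> r")
  case True
  then show ?thesis using e_poly_cong[of "f j" p] block_subset[OF assms(1)] assms(2)
    by (auto simp: block_poly_def block_def)
next
  case False
  have b: "f j \<in> factors" "monic_reciprocal (f j) \<in> factors"
    using block_subset[OF assms(1)] False by (auto simp: block_def)
  have "f j \<noteq> monic_reciprocal (f j)" by (rule f_neq_monic_reciprocal) (use assms(1) False in auto)
  then show ?thesis
    using cong_add[OF e_poly_cong[OF b(1) assms(2)] e_poly_cong[OF b(2) assms(2)]] False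
    by (auto simp: block_poly_def block_def split: if_splits)
qed

lemma monic_reciprocal_block:
  assumes "j \<in> {1..r+s}" "p \<in> block j"
  shows "monic_reciprocal p \<in> block j" "monic_reciprocal (monic_reciprocal p) = p"
    and "block j = {p, monic_reciprocal p}"
proof -
  have p: "p \<in> factors" using block_subset assms by blast
  have fj: "f j \<in> factors" using assms(1) by (auto simp: factors_eq)
  show inv: "monic_reciprocal (monic_reciprocal p) = p"
    by (rule monic_reciprocal_monic_reciprocal[OF factor_properties(6,3)[OF p]])
  have inv': "monic_reciprocal (monic_reciprocal (f j)) = f j"
    by (rule monic_reciprocal_monic_reciprocal[OF factor_properties(6,3)[OF fj]])
  have "monic_reciprocal (f j) = f j" if "j \<le> r"
  proof (rule monic_reciprocal_auto[OF _ factor_properties(3)[OF fj]])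
    show "auto_reciprocal (f j)" using factorization that assms(1) unfolding
        reciprocal_factorization_def by auto
  qed
  then show "monic_reciprocal p \<in> block j" "block j = {p, monic_reciprocal p}"
    using assms(2) inv inv' by (auto simp: block_def split: if_splits)
qed

lemma dih_flip_cong_factor:
  assumes "j \<in> {1..r+s}" "p \<in> block j" "[P = Q] (mod p)"
  shows "[dih_flip n P = dih_flip n Q] (mod monic_reciprocal p)"
proof (rule dih_flip_cong_monic_reciprocal[OF n_pos _ _ assms(3)])
  show "p \<noteq> 0" using factor_properties(7) block_subset assms by blast
  show "monic_reciprocal p dvd monom 1 n - 1"
    using factor_properties(4) block_subset[OF assms(1)] monic_reciprocal_block(1)[OF assms(1,2)]
        unfolding cyc_def by blast
qed

text \<open>
  The residues of \<open>block_poly j\<close> are constant on blocks, and blocks are closed under reciprocals.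
\<close>

lemma flip_block_poly:
  assumes "j \<in> {1..r+s}"
  shows "[dih_flip n (block_poly j) = block_poly j] (mod cyc)"
  unfolding cong_cyc_iff
proof
  fix q assume q: "q \<in> factors"
  then obtain i where i: "i \<in> {1..r+s}" "q \<in> block i" by (auto simp: factors_def)
  let ?p = "monic_reciprocal q"
  have p: "?p \<in> block i" "monic_reciprocal ?p = q" "?p \<in> factors"
    using monic_reciprocal_block[OF i] block_subset[OF i(1)] by auto
  have eq: "?p \<in> block j \<longleftrightarrow> q \<in> block j"
    using block_disjoint[OF i(1) assms i(2)] block_disjoint[OF i(1) assms p(1)] i p by auto
  have "[dih_flip n (block_poly j) = dih_flip n (if ?p \<in> block j then 1 else 0)] (mod q)"
    using dih_flip_cong_factor[OF i(1) p(1) block_poly_cong[OF assms p(3)]] p(2) by simp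
  also have "dih_flip n (if ?p \<in> block j then 1 else 0) = (if q \<in> block j then 1 else 0)"
    using eq by simp
  also have "[\<dots> = block_poly j] (mod q)" by (rule cong_sym[OF block_poly_cong[OF assms q]])
  finally show "[dih_flip n (block_poly j) = block_poly j] (mod q)" .
qed

lemma eps_le: "\<epsilon> \<le> r"
  using factorization eps unfolding reciprocal_factorization_def by auto

lemma linear_factor:
  assumes "j \<in> {1..\<epsilon>}"
  shows "f j = (if j = 1 then [:-1, 1:] else [:1, 1:])" "block j = {f j}" "j \<in> {1..r+s}" "(2::'a)
      \<noteq> 0"
proof -
  have "f 1 = [:-1, 1:]" "even n \<longrightarrow> f 2 = [:1, 1:]"
    using factorization unfolding reciprocal_factorization_def by auto
  moreover have "j = 1 \<or> j = 2 \<and> even n"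
    using assms eps by (auto split: if_splits)
  ultimately show "f j = (if j = 1 then [:-1, 1:] else [:1, 1:])" by auto
  show "block j = {f j}" using assms eps_le by (simp add: block_def)
  show "j \<in> {1..r+s}" using assms eps_le by auto
  show "(2::'a) \<noteq> 0" using assms eps by (auto split: if_splits)
qed

text \<open>
  The factors \<open>x \<mp> 1\<close> have the root \<open>\<plusminus>1\<close>, which is its own inverse; so \<open>x \<mapsto> x\<^sup>-\<^sup>1\<close> acts
  trivially on residues modulo these factors.
\<close>

lemma dih_flip_cong_self:
  assumes "j \<in> {1..\<epsilon>}"
  shows "[dih_flip n P = P] (mod (f j))"
proof -
  define a where "a = (if j = 1 then 1 else - 1 :: 'a)"
  have "a ^ n = 1"
  proof -
    have "poly cyc a = 0"
      using factor_properties(4)[of "f j"] block_subset[OF linear_factor(3)[OF assms]]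
          linear_factor(1,2)[OF assms]
      by (auto simp: a_def poly_eq_0_iff_dvd split: if_splits)
    then show ?thesis by (simp add: cyc_def poly_monom)
  qed
  then have "a * a ^ (n - 1) = a * a" using n_pos by (cases n) (auto simp: a_def)
  then have a: "a ^ (n - 1) = a" by (auto simp: a_def split: if_splits)
  have fj: "f j = [:- a, 1:]" using linear_factor(1)[OF assms] by (simp add: a_def)
  have "poly (dih_flip n P - P) a = 0" by (simp add: dih_flip_def poly_pcompose poly_monom a del:
      One_nat_def)
  then show ?thesis unfolding fj cong_iff_dvd_diff poly_eq_0_iff_dvd .
qed

text \<open>
  An irreducible divisor of \<open>x\<^sup>2 - 1\<close> is \<open>x - 1\<close> or \<open>x + 1\<close>, and if the characteristic is not 2,
      those of
  them that divide \<open>x\<^sup>n - 1\<close> make up the first \<open>\<epsilon>\<close> blocks.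
\<close>

lemma factor_not_dvd_square_minus_1:
  assumes "j \<in> {\<epsilon>+1..r+s}" "p \<in> block j" "(2::'a) \<noteq> 0"
  shows "\<not> p dvd monom 1 2 - 1"
proof
  assume d: "p dvd monom 1 2 - 1"
  have j: "j \<in> {1..r+s}" using assms by auto
  then have p: "p \<in> factors" using block_subset assms by blast
  have "monom 1 2 - 1 = [:-1, 1:] * [:1, 1 :: 'a:]"
    by (simp add: numeral_2_eq_2 monom_Suc one_pCons)
  then have "p dvd [:-1, 1:] \<or> p dvd [:1, 1:]"
    using d factor_properties(2)[OF p] by (simp only: prime_elem_dvd_mult_iff)
  then have pe: "p = [:-1, 1:] \<or> p = [:1, 1:]"
    using monic_irreducible_dvd_imp_eq[OF _ factor_properties(1)[OF p]
        irreducible_linear_field_poly _ ] factor_properties(3)[OF p] by auto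
  have eps1: "1 \<in> {1..\<epsilon>}" using assms eps by auto
  show False
  proof (cases "p = [:-1, 1:]")
    case True
    then have "p \<in> block 1" using linear_factor[OF eps1] by simp
    then show False using block_disjoint[OF j linear_factor(3)[OF eps1] assms(2)] assms(1) eps1 by
        auto
  next
    case False
    then have pp: "p = [:1, 1:]" using pe by simp
    have "poly cyc (- 1) = 0"
      using factor_properties(4)[OF p] pp by (simp add: poly_eq_0_iff_dvd)
    then have "(- 1 :: 'a) ^ n = 1" by (simp add: cyc_def poly_monom)
    moreover have "(- 1 :: 'a) \<noteq> 1" using assms(3) by (metis add.right_inverse one_add_one)
    ultimately have "even n" by (cases "even n") auto
    then have eps2: "2 \<in> {1..\<epsilon>}" using assms eps by auto
    then have "p \<in> block 2" using linear_factor[OF eps2] pp by simp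
    then show False using block_disjoint[OF j linear_factor(3)[OF eps2] assms(2)] assms(1) eps2 by
        auto
  qed
qed

section \<open>The block idempotents of the dihedral group algebra\<close>

abbreviation alg :: "('a, int \<times> bool \<Rightarrow> 'a) module" where "alg \<equiv> dihedral_algebra n"

definition half :: "'a poly" where "half = [:1/2:]"

text \<open>
  The idempotents of the theorem are \<open>(const_part j + y_part j b y) E\<close> with \<open>E\<close> the polynomial of
  the block: the first factor is \<open>(1 \<plusminus> y)/2\<close> for \<open>j \<le> \<epsilon>\<close>, with the sign given by \<open>b\<close>, and 1
  for all other \<open>j\<close>.
\<close>

definition const_part :: "nat \<Rightarrow> 'a poly" where
  "const_part j = (if j \<le> \<epsilon> then half else 1)"

definition y_part :: "nat \<Rightarrow> bool \<Rightarrow> 'a poly" where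
  "y_part j b = (if j \<le> \<epsilon> then (if b then half else - half) else 0)"

definition block_idempotent :: "nat \<Rightarrow> bool \<Rightarrow> int \<times> bool \<Rightarrow> 'a" where
  "block_idempotent j b = dih_elem n (const_part j * block_poly j) (y_part j b * block_poly j)"

lemma dih_elem_eq_iff_factors:
  "dih_elem n P Q = dih_elem n P' Q' \<longleftrightarrow> (\<forall>p\<in>factors. [P = P'] (mod p) \<and> [Q = (Q' :: 'a poly)] (mod
      p))"
  unfolding dih_elem_eq_iff[OF n_pos] cyc_def[symmetric] cong_cyc_iff by blast

lemma block_poly_cong_block:
  assumes "j \<in> {1..r+s}" "p \<in> factors"
  shows "p \<in> block j \<Longrightarrow> [R * block_poly j = R] (mod p)" "p \<notin> block j \<Longrightarrow> [R * block_poly j = 0] (mod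
      p)"
  using cong_scalar_left[OF block_poly_cong[OF assms], of R] by auto

lemma two_half:
  assumes "j \<in> {1..\<epsilon>}" shows "2 * half = 1"
  using linear_factor(4)[OF assms] by (simp add: half_def numeral_poly one_pCons)

text \<open>
  These are the identities that make \<open>(1 \<plusminus> y)/2\<close> a pair of orthogonal idempotents, written for the
  coefficients of 1 and \<open>y\<close>.
\<close>

lemma const_part_y_part_relations:
  assumes "j \<in> {1..r+s}"
  shows "const_part j * const_part j + y_part j b * y_part j b = const_part j"
    and "const_part j * y_part j b + y_part j b * const_part j = y_part j b"
    and "j \<le> \<epsilon> \<Longrightarrow> b \<noteq> c \<Longrightarrow> const_part j * const_part j + y_part j b * y_part j c = 0"
    and "j \<le> \<epsilon> \<Longrightarrow> b \<noteq> c \<Longrightarrow> const_part j * y_part j c + y_part j b * const_part j = 0"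
proof -
  have h: "h * h + h * h = h" if "2 * h = 1" for h :: "'a poly"
    using that by (metis distrib_right mult_1 mult_2)
  show "const_part j * const_part j + y_part j b * y_part j b = const_part j"
    "const_part j * y_part j b + y_part j b * const_part j = y_part j b"
    using h[OF two_half[of j]] assms unfolding const_part_def y_part_def
    by auto
  show "j \<le> \<epsilon> \<Longrightarrow> b \<noteq> c \<Longrightarrow> const_part j * const_part j + y_part j b * y_part j c = 0"
    "j \<le> \<epsilon> \<Longrightarrow> b \<noteq> c \<Longrightarrow> const_part j * y_part j c + y_part j b * const_part j = 0"
    unfolding const_part_def y_part_def
    by auto
qed

lemma flip_const_part_y_part: "dih_flip n (const_part j) = const_part j" "dih_flip n (y_part j b)
    = y_part j b"
proof -
  have "dih_flip n [:c:] = [:c:]" for c :: 'a by (simp add: dih_flip_def)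
  then show "dih_flip n (const_part j) = const_part j" "dih_flip n (y_part j b) = y_part j b"
    by (simp_all add: const_part_def y_part_def half_def)
qed

text \<open>
  The coefficient of \<open>y\<close> is nonzero only for the blocks of \<open>x \<mp> 1\<close>, and there
  \<open>x \<mapsto> x\<^sup>-\<^sup>1\<close> is trivial; this is why \<open>(1 \<plusminus> y)/2\<close> is central on these blocks although in
  general it is not central in the whole algebra.
\<close>

lemma y_part_block_poly_flip:
  assumes j: "j \<in> {1..r+s}"
  shows "[y_part j b * block_poly j * dih_flip n R = y_part j b * block_poly j * R] (mod cyc)"
  unfolding cong_cyc_iff
proof
  fix p assume p: "p \<in> factors"
  consider "p \<notin> block j" | "j \<in> {1..\<epsilon>}" "p \<in> block j" | "j > \<epsilon>" using j by force
  then show "[y_part j b * block_poly j * dih_flip n R = y_part j b * block_poly j * R] (mod p)"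
  proof cases
    case 1
    then have "[y_part j b * block_poly j * S = 0] (mod p)" for S
      using cong_scalar_right[OF block_poly_cong_block(2)[OF j p], of "y_part j b" S] by simp
    then show ?thesis by (meson cong_sym cong_trans)
  next
    case 2
    then have "[dih_flip n R = R] (mod p)" using dih_flip_cong_self linear_factor(2)[OF 2(1)] by
        auto
    then show ?thesis by (rule cong_scalar_left)
  next
    case 3
    then show ?thesis by (simp add: y_part_def)
  qed
qed

text \<open>
  Centrality of the block idempotents is read off here, since the two right-hand sides agree.  The
  substitution \<open>\<sigma>\<close> disappears from the product because \<open>block_poly j\<close> is fixed by it and
  \<open>y_part j b * block_poly j\<close> absorbs it.
\<close>

lemma block_idempotent_mult:
  assumes j: "j \<in> {1..r+s}"
  shows "block_idempotent j b \<otimes>\<^bsub>alg\<^esub> dih_elem n P Q =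
      dih_elem n ((const_part j * P + y_part j b * Q) * block_poly j)
        ((const_part j * Q + y_part j b * P) * block_poly j)"
    and "dih_elem n P Q \<otimes>\<^bsub>alg\<^esub> block_idempotent j b =
      dih_elem n ((const_part j * P + y_part j b * Q) * block_poly j)
        ((const_part j * Q + y_part j b * P) * block_poly j)"
proof -
  have 1: "[A * block_poly j * R + y_part j b * block_poly j * dih_flip n S = (A * R + y_part j b
      * S) * block_poly j] (mod cyc)" for A R S
    using cong_add[OF cong_refl[of "A * block_poly j * R"] y_part_block_poly_flip[OF j, of b S]]
        by (simp add: algebra_simps)
  show "block_idempotent j b \<otimes>\<^bsub>alg\<^esub> dih_elem n P Q =
      dih_elem n ((const_part j * P + y_part j b * Q) * block_poly j)
        ((const_part j * Q + y_part j b * P) * block_poly j)"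
    unfolding block_idempotent_def dih_elem_mult[OF n_pos] dih_elem_eq_iff[OF n_pos]
        cyc_def[symmetric]
    using 1 by blast
  have 2: "[R * (A * block_poly j) + S * dih_flip n (B * block_poly j) =
      (A * R + B * S) * block_poly j] (mod cyc)"
    if "dih_flip n B = B" for A B R S
    using cong_add[OF cong_refl[of "R * (A * block_poly j)"] cong_scalar_left[OF
        flip_block_poly[OF j], of "S * B"]] that
    by (simp add: algebra_simps)
  show "dih_elem n P Q \<otimes>\<^bsub>alg\<^esub> block_idempotent j b =
      dih_elem n ((const_part j * P + y_part j b * Q) * block_poly j)
        ((const_part j * Q + y_part j b * P) * block_poly j)"
    unfolding block_idempotent_def dih_elem_mult[OF n_pos] dih_elem_eq_iff[OF n_pos]
        cyc_def[symmetric]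
    using 2[OF flip_const_part_y_part(2)[of j b], of P "const_part j" Q] 2[OF
        flip_const_part_y_part(1)[of j], of P "y_part j b" Q]
    by (simp add: add.commute)
qed

lemma dih_elem_block_poly_eq_iff:
  assumes "j \<in> {1..r+s}"
  shows "dih_elem n (R * block_poly j) (S * block_poly j) = dih_elem n P Q \<longleftrightarrow>
    (\<forall>p\<in>factors. if p \<in> block j then [R = P] (mod p) \<and> [S = Q] (mod p)
      else [P = 0] (mod p) \<and> [Q = 0] (mod p))"
proof -
  have "[T * block_poly j = U] (mod p) \<longleftrightarrow> (if p \<in> block j then [T = U] (mod p) else [U = 0] (mod p))"
    if "p \<in> factors" for p T U
    using block_poly_cong_block[OF assms that, of T] by (auto intro: cong_sym cong_trans)
  then show ?thesis unfolding dih_elem_eq_iff_factors by (auto split: if_splits)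
qed

lemma central_idempotent_block_idempotent:
  assumes j: "j \<in> {1..r+s}"
  shows "central_idempotent alg (block_idempotent j b)"
  unfolding central_idempotent_def
proof (intro conjI ballI)
  show "block_idempotent j b \<in> carrier alg" by (simp add: block_idempotent_def n_pos)
  have "block_idempotent j b \<otimes>\<^bsub>alg\<^esub> block_idempotent j b =
    dih_elem n ((const_part j * const_part j + y_part j b * y_part j b) * block_poly j *
        block_poly j)
      ((const_part j * y_part j b + y_part j b * const_part j) * block_poly j * block_poly j)"
    unfolding block_idempotent_def[of j b, THEN arg_cong, of "\<lambda>u. block_idempotent j b \<otimes>\<^bsub>alg\<^esub> u"]
        block_idempotent_mult[OF j]
    by (simp add: algebra_simps)
  also have "\<dots> = block_idempotent j b"
    unfolding const_part_y_part_relations[OF j] block_idempotent_def dih_elem_block_poly_eq_iff[OF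
        j]
    by (auto intro: block_poly_cong_block[OF j])
  finally show "block_idempotent j b \<otimes>\<^bsub>alg\<^esub> block_idempotent j b = block_idempotent j b" .
  fix a assume "a \<in> carrier alg"
  then obtain P Q where "a = dih_elem n P Q" by (rule dih_elem_surj[OF n_pos])
  then show "block_idempotent j b \<otimes>\<^bsub>alg\<^esub> a = a \<otimes>\<^bsub>alg\<^esub> block_idempotent j b"
    by (simp add: block_idempotent_mult[OF j])
qed

lemma block_idempotent_nonzero:
  assumes j: "j \<in> {1..r+s}"
  shows "block_idempotent j b \<noteq> \<zero>\<^bsub>alg\<^esub>"
proof
  assume "block_idempotent j b = \<zero>\<^bsub>alg\<^esub>"
  moreover have p: "f j \<in> block j" "f j \<in> factors" using block_subset[OF j] by (auto simp:
      block_def)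
  ultimately have "[const_part j = 0] (mod (f j))"
    unfolding dih_elem_zero[OF n_pos] block_idempotent_def dih_elem_block_poly_eq_iff[OF j] by auto
  then have d: "f j dvd const_part j" by (simp add: cong_0_iff)
  have "f j dvd 1"
  proof (cases "j \<le> \<epsilon>")
    case True
    then have "f j dvd 2 * half" using dvd_mult[OF d, of 2] by (simp add: const_part_def)
    then show ?thesis using two_half[of j] True j by simp
  qed (use d in \<open>simp add: const_part_def\<close>)
  then show False using factor_properties(1)[OF p(2)] irreducible_not_unit by blast
qed

lemma block_idempotent_orthogonal:
  assumes j: "j \<in> {1..r+s}" and k: "k \<in> {1..r+s}"
    and ne: "j \<noteq> k \<or> j \<le> \<epsilon> \<and> b \<noteq> c"
  shows "block_idempotent j b \<otimes>\<^bsub>alg\<^esub> block_idempotent k c = \<zero>\<^bsub>alg\<^esub>"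
proof -
  have "block_idempotent j b \<otimes>\<^bsub>alg\<^esub> block_idempotent k c =
    dih_elem n ((const_part j * const_part k + y_part j b * y_part k c) * block_poly k *
        block_poly j)
      ((const_part j * y_part k c + y_part j b * const_part k) * block_poly k * block_poly j)"
    unfolding block_idempotent_def[of k c] block_idempotent_mult[OF j] by (simp add: algebra_simps)
  also have "\<dots> = \<zero>\<^bsub>alg\<^esub>"
  proof (cases "j = k")
    case True
    then show ?thesis using ne const_part_y_part_relations(3,4)[OF j, of b c] by (simp add:
        dih_elem_zero n_pos)
  next
    case False
    then have "p \<notin> block k" if "p \<in> block j" for p using block_disjoint[OF j k that] by blast
    then show ?thesis
      unfolding dih_elem_zero[OF n_pos] dih_elem_block_poly_eq_iff[OF j] by (auto intro:
          block_poly_cong_block(2)[OF k])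
  qed
  finally show ?thesis .
qed

text \<open>
  For \<open>j \<le> \<epsilon>\<close> both signs are available, and \<open>(1 + y)/2 + (1 - y)/2 = 1\<close>; so no information on the
  residues modulo \<open>f\<^sub>j\<close> is lost.
\<close>

lemma block_idempotents_complete:
  assumes u: "u \<in> carrier alg"
    and kill: "\<And>j b. j \<in> {1..r+s} \<Longrightarrow> (\<epsilon> < j \<Longrightarrow> b) \<Longrightarrow> block_idempotent j b \<otimes>\<^bsub>alg\<^esub> u = \<zero>\<^bsub>alg\<^esub>"
  shows "u = \<zero>\<^bsub>alg\<^esub>"
proof -
  obtain P Q where u: "u = dih_elem n P Q" using u by (rule dih_elem_surj[OF n_pos])
  have "[P = 0] (mod p) \<and> [Q = 0] (mod p)" if p: "p \<in> factors" for p
  proof -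
    obtain j where j: "j \<in> {1..r+s}" "p \<in> block j" using p by (auto simp: factors_def)
    have *: "p dvd const_part j * P + y_part j b * Q" "p dvd const_part j * Q + y_part j b * P" if
        "\<epsilon> < j \<Longrightarrow> b" for b
      using kill[OF j(1) that] p j(2)
      unfolding u block_idempotent_mult[OF j(1)] dih_elem_zero[OF n_pos]
          dih_elem_block_poly_eq_iff[OF j(1)]
      by (auto simp: cong_0_iff)
    show ?thesis
    proof (cases "j \<le> \<epsilon>")
      case True
      have "p dvd (const_part j * P + y_part j True * Q) + (const_part j * P + y_part j False * Q)"
        "p dvd (const_part j * Q + y_part j True * P) + (const_part j * Q + y_part j False * P)"
        using True by (intro dvd_add *; simp)+
      moreover have "(const_part j * R + y_part j True * S) + (const_part j * R + y_part j False *
          S) = (2 * half) * R" for R S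
        using True by (simp add: const_part_def y_part_def algebra_simps)
      ultimately show ?thesis using two_half[of j] True j(1) by (simp add: cong_0_iff)
    next
      case False
      then show ?thesis using *[of True] by (simp add: const_part_def y_part_def cong_0_iff)
    qed
  qed
  then show ?thesis unfolding u dih_elem_zero[OF n_pos] dih_elem_eq_iff_factors by blast
qed

text \<open>
  The first two congruences express commuting with \<open>y\<close>.  Commuting with \<open>x\<close> says that
  \<open>Q x\<^sup>-\<^sup>1 = x Q\<close>, which is the third.  The last two are idempotence, simplified by the first two.
\<close>

lemma central_idempotent_dih_elemD:
  assumes "central_idempotent alg (dih_elem n P Q)"
  shows "[dih_flip n P = P] (mod cyc)" "[dih_flip n Q = Q] (mod cyc)"
    "[(monom 1 2 - 1) * Q = 0] (mod cyc)" "[P * P + Q * Q = P] (mod cyc)" "[2 * P * Q = Q] (mod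
        cyc)"
proof -
  note c = central_idempotentD[OF assms]
  have comm: "dih_elem n P Q \<otimes>\<^bsub>alg\<^esub> dih_elem n R S = dih_elem n R S \<otimes>\<^bsub>alg\<^esub> dih_elem n P Q" for R S
    using c(3) n_pos by simp
  show fl: "[dih_flip n P = P] (mod cyc)" "[dih_flip n Q = Q] (mod cyc)"
    using comm[of 0 1] unfolding dih_elem_mult[OF n_pos] dih_elem_eq_iff[OF n_pos]
        cyc_def[symmetric]
    by (simp_all add: cong_sym_eq)
  have "[Q * monom 1 (n - 1) = monom 1 1 * Q] (mod cyc)"
    using comm[of "monom 1 1" 0] unfolding dih_elem_mult[OF n_pos] dih_elem_eq_iff[OF n_pos]
        cyc_def[symmetric]
    by simp
  then have "[monom 1 1 * (Q * monom 1 (n - 1)) = monom 1 1 * (monom 1 1 * Q)] (mod cyc)"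
    by (rule cong_scalar_left)
  moreover have "monom 1 1 * (Q * monom 1 (n - 1)) = (monom 1 1 * monom 1 (n - 1)) * Q"
    by (simp add: mult_ac)
  moreover have "monom 1 1 * monom 1 (n - 1) = (monom 1 n :: 'a poly)"
    using n_pos by (simp add: mult_monom)
  moreover have "monom 1 1 * (monom 1 1 * Q) = monom 1 2 * Q"
    unfolding mult.assoc[symmetric] mult_monom by (simp add: numeral_2_eq_2)
  ultimately have "[monom 1 n * Q = monom 1 2 * Q] (mod cyc)" by (simp only:)
  moreover have "[monom 1 n * Q = 1 * Q] (mod cyc)"
    by (rule cong_scalar_right) (simp add: cyc_def cong_iff_dvd_diff)
  ultimately have "[monom 1 2 * Q = Q] (mod cyc)"
    by (metis cong_sym cong_trans mult_1)
  then show "[(monom 1 2 - 1) * Q = 0] (mod cyc)"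
    by (simp add: cong_iff_dvd_diff algebra_simps)
  have id: "[P * P + Q * dih_flip n Q = P] (mod cyc)" "[P * Q + Q * dih_flip n P = Q] (mod cyc)"
    using c(2) unfolding dih_elem_mult[OF n_pos] dih_elem_eq_iff[OF n_pos] cyc_def[symmetric] by
        simp_all
  have "[P * P + Q * Q = P * P + Q * dih_flip n Q] (mod cyc)"
    by (intro cong_add cong_scalar_left cong_refl cong_sym[OF fl(2)])
  then show "[P * P + Q * Q = P] (mod cyc)" using id(1) by (rule cong_trans)
  have "[P * Q + Q * P = P * Q + Q * dih_flip n P] (mod cyc)"
    by (intro cong_add cong_scalar_left cong_refl cong_sym[OF fl(1)])
  then have "[P * Q + Q * P = Q] (mod cyc)" using id(2) by (rule cong_trans)
  then show "[2 * P * Q = Q] (mod cyc)" by (simp add: algebra_simps mult_2)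
qed

text \<open>
  Modulo the members of the block the pair \<open>(P, Q)\<close> is a solution of \<open>P\<^sup>2 + Q\<^sup>2 = P\<close> and
  \<open>2 P Q = Q\<close> in a field.  If the characteristic is not 2, there are four solutions, namely \<open>(0,
      0)\<close>, \<open>(1, 0)\<close> and
  \<open>(1/2, \<plusminus>1/2)\<close>.  On the first \<open>\<epsilon>\<close> blocks lying below \<open>(1 \<plusminus> y)/2\<close> selects \<open>(0, 0)\<close> and one of
  the last two; on the other blocks \<open>Q\<close> vanishes, because \<open>x\<^sup>2 - 1\<close> is invertible there or the
  characteristic is 2.
\<close>

lemma block_idempotent_primitive:
  assumes j: "j \<in> {1..r+s}" and u: "central_idempotent alg u" and le: "block_idempotent j b \<otimes>\<^bsub>alg\<^esub>
      u = u"
  shows "u = \<zero>\<^bsub>alg\<^esub> \<or> u = block_idempotent j b"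
proof -
  obtain P Q where uPQ: "u = dih_elem n P Q"
    using central_idempotentD(1)[OF u] by (rule dih_elem_surj[OF n_pos])
  have out: "[P = 0] (mod p)" "[Q = 0] (mod p)" if "p \<in> factors" "p \<notin> block j" for p
    using le that unfolding uPQ block_idempotent_mult[OF j] dih_elem_block_poly_eq_iff[OF j] by auto
  have inn: "[const_part j * P + y_part j b * Q = P] (mod p)" if "p \<in> block j" for p
    using le that block_subset[OF j] unfolding uPQ block_idempotent_mult[OF j]
        dih_elem_block_poly_eq_iff[OF j] by auto
  note c = central_idempotent_dih_elemD[OF u[unfolded uPQ], unfolded cong_cyc_iff]
  have zero: "u = \<zero>\<^bsub>alg\<^esub>" if "\<And>p. p \<in> block j \<Longrightarrow> [P = 0] (mod p) \<and> [Q = 0] (mod p)"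
    unfolding uPQ dih_elem_zero[OF n_pos] dih_elem_eq_iff_factors using that out by blast
  have full: "u = block_idempotent j b" if "\<And>p. p \<in> block j \<Longrightarrow> [P = const_part j] (mod p) \<and> [Q =
      y_part j b] (mod p)"
  proof -
    have "block_idempotent j b = u"
      unfolding uPQ block_idempotent_def dih_elem_block_poly_eq_iff[OF j] using that out by (auto
          intro: cong_sym)
    then show ?thesis by simp
  qed
  have fj: "f j \<in> block j" "f j \<in> factors" using block_subset[OF j] by (auto simp: block_def)
  note prime = prime_elem_dvd_mult_iff[OF factor_properties(2)]
  show ?thesis
  proof (cases "j \<le> \<epsilon>")
    case True
    then have je: "j \<in> {1..\<epsilon>}" using j by simp
    have bl: "block j = {f j}" by (rule linear_factor(2)[OF je])
    define h where "h = half"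
    define t where "t = (if b then 1 else - 1 :: 'a poly)"
    have h: "2 * h = 1" unfolding h_def by (rule two_half[OF je])
    have t: "t * t = 1" by (simp add: t_def)
    have cf: "const_part j = h" "y_part j b = t * h" using True by (auto simp: const_part_def
        y_part_def h_def t_def)
    \<comment> \<open>lying below \<open>(1 \<plusminus> y)/2\<close> gives \<open>P = (P \<plusminus> Q)/2\<close>, hence \<open>Q = \<plusminus>P\<close>\<close>
    have "f j dvd (2 * t) * (P - (h * P + t * h * Q))"
      using inn[OF fj(1)] unfolding cf cong_iff_dvd_diff by (metis dvd_mult dvd_diff_commute)
    also have "(2 * t) * (P - (h * P + t * h * Q)) = t * (2 * P) - (2 * h) * t * P - (2 * h) * (t
        * t) * Q"
      by (simp add: algebra_simps)
    also have "\<dots> = t * P - Q" unfolding h t by (simp add: algebra_simps)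
    finally have Q: "[Q = t * P] (mod (f j))" unfolding cong_iff_dvd_diff by (simp add:
        dvd_diff_commute)
    have "f j dvd 2 * P * Q - Q" using c(5) fj(2) unfolding cong_iff_dvd_diff by blast
    also have "2 * P * Q - Q = (2 * P - 1) * Q" by (simp add: algebra_simps)
    finally have "f j dvd 2 * P - 1 \<or> f j dvd Q" by (simp only: prime[OF fj(2)])
    then show ?thesis
    proof
      assume "f j dvd 2 * P - 1"
      then have "f j dvd h * (2 * P - 1)" by (rule dvd_mult)
      also have "h * (2 * P - 1) = (2 * h) * P - h" by (simp add: algebra_simps)
      finally have P: "[P = h] (mod (f j))" unfolding h cong_iff_dvd_diff by simp
      have "[Q = t * h] (mod (f j))" by (rule cong_trans[OF Q cong_scalar_left[OF P]])
      then show ?thesis using full P unfolding bl cf by blast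
    next
      assume Q0: "f j dvd Q"
      then have "f j dvd t * (t * P)" using cong_dvd_iff[OF Q] by (auto intro: dvd_mult)
      then have "f j dvd P" unfolding mult.assoc[symmetric] t by simp
      then show ?thesis using zero Q0 unfolding bl cong_0_iff by blast
    qed
  next
    case False
    have cf: "const_part j = 1" "y_part j b = 0" using False by (auto simp: const_part_def
        y_part_def)
    have Q: "[Q = 0] (mod p)" if p: "p \<in> block j" for p
    proof (cases "(2::'a) = 0")
      case True
      then have "(2 :: 'a poly) = 0" by (simp add: numeral_poly)
      then show ?thesis using c(5) block_subset[OF j] p by (auto simp: cong_sym_eq)
    next
      case 2: False
      have pf: "p \<in> factors" using block_subset[OF j] p by blast
      have "p dvd (monom 1 2 - 1) * Q" using c(3) pf unfolding cong_0_iff by blast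
      then show ?thesis using factor_not_dvd_square_minus_1[of j p] False j p 2 unfolding prime[OF
          pf] cong_0_iff by auto
    qed
    have "f j dvd P * P + Q * Q - P" using c(4) fj(2) unfolding cong_iff_dvd_diff by blast
    moreover have "f j dvd Q * Q" using Q[OF fj(1)] by (simp add: cong_0_iff)
    ultimately have "f j dvd (P * P + Q * Q - P) - Q * Q" by (rule dvd_diff)
    also have "(P * P + Q * Q - P) - Q * Q = P * (P - 1)" by (simp add: algebra_simps)
    finally have "f j dvd P \<or> f j dvd P - 1" by (simp only: prime[OF fj(2)])
    \<comment> \<open>the residue \<open>d\<close> modulo \<open>f\<^sub>j\<close> is also the residue modulo \<open>f\<^sub>j\<^sup>*\<close>, as \<open>\<sigma>(P) = P\<close>\<close>
    then obtain d where d: "d = 0 \<or> d = 1" "[P = d] (mod (f j))" unfolding cong_iff_dvd_diff by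
        (metis diff_0_right)
    have "[P = d] (mod p)" if p: "p \<in> block j" for p
    proof -
      have "p = f j \<or> p = monic_reciprocal (f j)" using monic_reciprocal_block(3)[OF j fj(1)] p by
          blast
      moreover have "[P = d] (mod monic_reciprocal (f j))"
      proof -
        have m: "monic_reciprocal (f j) \<in> factors" using monic_reciprocal_block(1)[OF j fj(1)]
            block_subset[OF j] by blast
        have "[P = dih_flip n P] (mod monic_reciprocal (f j))" using c(1) m by (blast intro:
            cong_sym)
        also have "[dih_flip n P = dih_flip n d] (mod monic_reciprocal (f j))" by (rule
            dih_flip_cong_factor[OF j fj(1) d(2)])
        also have "dih_flip n d = d" using d(1) by auto
        finally show ?thesis .
      qed
      ultimately show ?thesis using d(2) by blast
    qed
    then show ?thesis using d(1) zero full Q unfolding cf by blast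
  qed
qed

text \<open>
  For \<open>j > \<epsilon>\<close> the idempotent does not depend on the sign; \<open>True\<close> is an arbitrary choice that keeps
  the indexing injective.
\<close>

definition block_index :: "(nat \<times> bool) set" where
  "block_index = {1..\<epsilon>} \<times> UNIV \<union> {\<epsilon>+1..r+s} \<times> {True}"

lemma central_irreducible_idempotents:
  "{e. central_irreducible_idempotent alg e} = (\<lambda>(j, b). block_idempotent j b) ` block_index"
  "inj_on (\<lambda>(j, b). block_idempotent j b) block_index"
proof -
  interpret A: ring alg by (rule dih_ring[OF n_pos])
  have idx: "fst i \<in> {1..r+s}" if "i \<in> block_index" for i
    using that eps_le by (auto simp: block_index_def)
  have 1: "central_idempotent alg (case i of (j, b) \<Rightarrow> block_idempotent j b)"
      "(case i of (j, b) \<Rightarrow> block_idempotent j b) \<noteq> \<zero>\<^bsub>alg\<^esub>" if "i \<in> block_index" for i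
    using central_idempotent_block_idempotent block_idempotent_nonzero idx[OF that] by (auto
        split: prod.splits)
  have 2: "(case i of (j, b) \<Rightarrow> block_idempotent j b) \<otimes>\<^bsub>alg\<^esub> (case k of (j, b) \<Rightarrow> block_idempotent j
      b) = \<zero>\<^bsub>alg\<^esub>"
    if "i \<in> block_index" "k \<in> block_index" "i \<noteq> k" for i k
    using block_idempotent_orthogonal[OF idx[OF that(1)] idx[OF that(2)], of "snd i" "snd k"] that
    by (auto simp: block_index_def split: prod.splits)
  have 3: "u = \<zero>\<^bsub>alg\<^esub>" if u: "u \<in> carrier alg"
    and k: "\<And>i. i \<in> block_index \<Longrightarrow> (case i of (j, b) \<Rightarrow> block_idempotent j b) \<otimes>\<^bsub>alg\<^esub> u = \<zero>\<^bsub>alg\<^esub>" for u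
  proof (rule block_idempotents_complete[OF u])
    fix j b assume "j \<in> {1..r+s}" "\<epsilon> < j \<Longrightarrow> b"
    then have "(j, b) \<in> block_index" by (auto simp: block_index_def)
    from k[OF this] show "block_idempotent j b \<otimes>\<^bsub>alg\<^esub> u = \<zero>\<^bsub>alg\<^esub>" by simp
  qed
  have 4: "u = \<zero>\<^bsub>alg\<^esub> \<or> u = (case i of (j, b) \<Rightarrow> block_idempotent j b)"
    if "i \<in> block_index" "central_idempotent alg u" "(case i of (j, b) \<Rightarrow> block_idempotent j b)
        \<otimes>\<^bsub>alg\<^esub> u = u" for i u
    using block_idempotent_primitive[OF idx[OF that(1)] that(2), of "snd i"] that(3) by (auto
        split: prod.splits)
  show "{e. central_irreducible_idempotent alg e} = (\<lambda>(j, b). block_idempotent j b) ` block_index"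
    by (rule A.central_irreducible_idempotents_eq_image(1); fact 1 2 3 4)
  show "inj_on (\<lambda>(j, b). block_idempotent j b) block_index"
    by (rule A.central_irreducible_idempotents_eq_image(2); fact 1 2 3 4)
qed

lemma e_elem_eq: "e_elem n p = dih_elem n (e_poly n p) (0 :: 'a poly)"
  by (simp add: e_elem_def poly_subst_dihedral_x[OF n_pos])

lemma block_idempotent_eq:
  shows "j \<in> {1..\<epsilon>} \<Longrightarrow> half_plus n \<otimes>\<^bsub>alg\<^esub> e_elem n (f j) = block_idempotent j True"
    and "j \<in> {1..\<epsilon>} \<Longrightarrow> half_minus n \<otimes>\<^bsub>alg\<^esub> e_elem n (f j) = block_idempotent j False"
    and "j \<in> {\<epsilon>+1..r} \<Longrightarrow> e_elem n (f j) = block_idempotent j True"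
    and "j \<in> {r+1..r+s} \<Longrightarrow> e_elem n (f j) \<oplus>\<^bsub>alg\<^esub> e_elem n (monic_reciprocal (f j)) =
        block_idempotent j True"
proof -
  have *: "dih_elem n h k \<otimes>\<^bsub>alg\<^esub> e_elem n (f j) = dih_elem n (h * block_poly j) (k * block_poly
      j)" if "j \<in> {1..\<epsilon>}" for j h k
  proof -
    have "block_poly j = e_poly n (f j)" using that eps_le by (simp add: block_poly_def)
    then show ?thesis using cong_scalar_left[OF flip_block_poly[OF linear_factor(3)[OF that]], of k]
      unfolding e_elem_eq dih_elem_mult[OF n_pos] dih_elem_eq_iff[OF n_pos] cyc_def[symmetric] by
          simp
  qed
  show "half_plus n \<otimes>\<^bsub>alg\<^esub> e_elem n (f j) = block_idempotent j True" if "j \<in> {1..\<epsilon>}"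
    unfolding half_plus_eq[OF n_pos] *[OF that] using that by (simp add: block_idempotent_def
        const_part_def y_part_def half_def)
  show "half_minus n \<otimes>\<^bsub>alg\<^esub> e_elem n (f j) = block_idempotent j False" if "j \<in> {1..\<epsilon>}"
    unfolding half_minus_eq[OF n_pos] *[OF that] using that by (simp add: block_idempotent_def
        const_part_def y_part_def half_def)
  show "e_elem n (f j) = block_idempotent j True" if "j \<in> {\<epsilon>+1..r}"
    using that by (simp add: e_elem_eq block_idempotent_def const_part_def y_part_def
        block_poly_def)
  show "e_elem n (f j) \<oplus>\<^bsub>alg\<^esub> e_elem n (monic_reciprocal (f j)) = block_idempotent j True" if "j \<in>
      {r+1..r+s}"
    using that eps_le by (simp add: e_elem_eq dih_elem_add[OF n_pos] block_idempotent_def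
        const_part_def y_part_def block_poly_def)
qed

end

section \<open>The dihedral group algebra over a finite field\<close>

text \<open>
  Adding 1 permutes the ring, so the sum of all elements does not change when 1 is added to each.
\<close>

lemma of_nat_card_eq_0: "of_nat CARD('a) = (0 :: 'a::{comm_ring_1, finite})"
proof -
  have "(\<Sum>x\<in>(UNIV::'a set). x + 1) = (\<Sum>x\<in>UNIV. x)"
    by (rule sum.reindex_bij_witness[of _ "\<lambda>x. x - 1" "\<lambda>x. x + 1"]) auto
  then show ?thesis by (simp add: sum.distrib)
qed

theorem theorem3p3:
  fixes n r s \<epsilon> :: nat and f :: "nat \<Rightarrow> 'a::{field, finite} poly"
  assumes "n > 0" and "coprime n CARD('a)"
    and "reciprocal_factorization n r s f"
    and "\<epsilon> = (if CHAR('a) = 2 then 0 else if odd n then 1 else 2)"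
  shows
    "let A = dihedral_algebra n;
         I1 = {half_plus n \<otimes>\<^bsub>A\<^esub> e_elem n (f j) | j. j \<in> {1..\<epsilon>}} \<union>
              {half_minus n \<otimes>\<^bsub>A\<^esub> e_elem n (f j) | j. j \<in> {1..\<epsilon>}};
         I2 = {e_elem n (f j) | j. j \<in> {\<epsilon>+1..r}};
         I3 = {e_elem n (f j) \<oplus>\<^bsub>A\<^esub> e_elem n (monic_reciprocal (f j)) | j. j \<in> {r+1..r+s}}
     in {e. central_irreducible_idempotent A e} = I1 \<union> I2 \<union> I3 \<and>
        card {e. central_irreducible_idempotent A e} = \<epsilon> + r + s \<and>
        card I1 = 2 * \<epsilon> \<and> card I2 = r - \<epsilon> \<and> card I3 = s"
proof -
  have ch1: "\<not> CHAR('a) dvd 1"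
    using of_nat_eq_0_iff_char_dvd[of 1, where 'a='a] by simp
  have nz: "(of_nat n :: 'a) \<noteq> 0"
  proof
    assume "(of_nat n :: 'a) = 0"
    then have "CHAR('a) dvd n" "CHAR('a) dvd CARD('a)"
      using of_nat_card_eq_0[where 'a='a] by (simp_all add: of_nat_eq_0_iff_char_dvd)
    then show False using coprime_common_divisor[OF assms(2), of "CHAR('a)"] ch1 by blast
  qed
  have "(2::'a) = 0 \<longleftrightarrow> CHAR('a) dvd 2"
    using of_nat_eq_0_iff_char_dvd[of 2, where 'a='a] by simp
  also have "\<dots> \<longleftrightarrow> CHAR('a) = 2"
    using ch1 dvd_imp_le[of "CHAR('a)" 2] by (auto simp: le_Suc_eq numeral_2_eq_2)
  finally have two: "CHAR('a) = 2 \<longleftrightarrow> (2::'a) = 0" by simp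
  interpret dihedral_factorization n r s \<epsilon> f
    by unfold_locales (use assms nz two in auto)
  let ?g = "\<lambda>(j, b). block_idempotent j b"
  define J1 J2 J3 where J: "J1 = {1..\<epsilon>} \<times> (UNIV :: bool set)" "J2 = {\<epsilon>+1..r} \<times> {True}" "J3 =
      {r+1..r+s} \<times> {True}"
  have J_index: "block_index = J1 \<union> J2 \<union> J3" using eps_le by (auto simp: J block_index_def)
  have img: "?g ` (S \<times> {b}) = (\<lambda>j. block_idempotent j b) ` S" for S b
    by force
  have "J1 = {1..\<epsilon>} \<times> {True} \<union> {1..\<epsilon>} \<times> {False}" by (auto simp: J)
  then have I1: "{half_plus n \<otimes>\<^bsub>alg\<^esub> e_elem n (f j) | j. j \<in> {1..\<epsilon>}} \<union>
      {half_minus n \<otimes>\<^bsub>alg\<^esub> e_elem n (f j) | j. j \<in> {1..\<epsilon>}} = ?g ` J1"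
    unfolding Setcompr_eq_image
    by (simp only: image_Un img) (intro arg_cong2[where f = "(\<union>)"] image_cong refl
        block_idempotent_eq(1,2))
  have I2: "{e_elem n (f j) | j. j \<in> {\<epsilon>+1..r}} = ?g ` J2"
    unfolding Setcompr_eq_image J img by (intro image_cong refl block_idempotent_eq(3))
  have I3: "{e_elem n (f j) \<oplus>\<^bsub>alg\<^esub> e_elem n (monic_reciprocal (f j)) | j. j \<in> {r+1..r+s}} = ?g ` J3"
    unfolding Setcompr_eq_image J img by (intro image_cong refl block_idempotent_eq(4))
  have inj: "inj_on ?g J1" "inj_on ?g J2" "inj_on ?g J3"
    by (rule inj_on_subset[OF central_irreducible_idempotents(2)], use J_index in blast)+
  have cards: "card J1 = 2 * \<epsilon>" "card J2 = r - \<epsilon>" "card J3 = s"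
    by (simp_all add: J card_cartesian_product)
  have "card block_index = card J1 + card J2 + card J3"
    unfolding J_index by (subst card_Un_disjoint; (subst card_Un_disjoint)?) (use eps_le in \<open>auto
        simp: J\<close>)
  then have ci: "card block_index = \<epsilon> + r + s" unfolding cards using eps_le by simp
  show ?thesis
    unfolding Let_def I1 I2 I3 central_irreducible_idempotents(1) image_Un[symmetric]
        J_index[symmetric]
    using inj cards ci central_irreducible_idempotents(2) by (simp add: card_image)
qed

end
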